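(* For the six multivalued SCI problems $P_{\mathrm A},Q_{\mathrm A},P_{\mathrm B},Q_{\mathrm B},P_{\mathrm C},Q_{\mathrm C}$ there are transports $$P_{\mathrm A}\leq^{\mathrm{mv}}_{\mathrm{TTE},\mathrm{fq}}P_{\mathrm B}\leq^{\mathrm{mv}}_{\mathrm{TTE},\mathrm{fq}}P_{\mathrm C},$$ and all six problems are raw-finite-query equivalent (that is, pairwise equivalent under $\leq^{\mathrm{mv}}_{\mathrm{raw},\mathrm{fq}}$ in both directions).
   Context: Type-2 conventions. $\mathbb N=\{0,1,2,\dots\}$; computable codings of rationals and finite tuples, and computable pairings $\langle\cdot,\cdot\rangle$ on $\mathbb N$ and on Baire space $\mathbb N^{\mathbb N}$, are fixed. A representation is a partial surjection $\delta_X:\subseteq\mathbb N^{\mathbb N}\to X$. Real Cauchy representation: $\rho(p)=x$ iff $|r_j-x|\leq2^{-j}$ for all $j$, $r_j$ the rational coded by $p(j)$. $\operatorname{Lim}(P)(j)=\lim_sP(\langle s,j\rangle)$, with domain those $P$ all of whose columns are eventually constant. Payloads. $\delta_C$ names $h\in C([0,1],\mathbb R)$ by sequences of (codes of) rational polygonal functions $P_n$ with $\|P_n-h\|_\infty\leq2^{-n}$. A negative name of a closed interval $J\subseteq[0,1]$ enumerates rational relatively open intervals of $[0,1]$ with union $[0,1]\setminus J$ (padding allowed). Let $\mathcal H=\{h\in C([0,1],\mathbb R):h(0)<0<h(1),\ h^{-1}(0)\subseteq[1/3,2/3]\}$ with $\delta_H$ the restriction of $\delta_C$, and $\mathcal J=\{[a,b]:1/3\leq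 a\leq b\leq2/3\}$ with $\delta_J$ the restricted negative-information representation; $D_H=\operatorname{dom}(\delta_H)$, $D_J=\operatorname{dom}(\delta_J)$, $Z(h)=h^{-1}(0)$. Define - $D^H_{\mathrm A}=\{\langle u,v\rangle:u\in D_H,\rho(v)\in Z(\delta_H(u))\}$, $h_{\mathrm A}(\langle u,v\rangle)=\delta_H(u)$; $D^H_{\mathrm B}=D_H$, $h_{\mathrm B}(u)=\delta_H(u)$; $D^H_{\mathrm C}=\{p\in\operatorname{dom}(\operatorname{Lim}):\operatorname{Lim}(p)\in D_H\}$, $h_{\mathrm C}(p)=\delta_H(\operatorname{Lim}(p))$. - $D^J_{\mathrm A}=\{\langle q,v\rangle:q\in D_J,\rho(v)\in\delta_J(q)\}$, $J_{\mathrm A}(\langle q,v\rangle)=\delta_J(q)$; $D^J_{\mathrm B}=D_J$, $J_{\mathrm B}(q)=\delta_J(q)$; $D^J_{\mathrm C}=\{q\in\operatorname{dom}(\operatorname{Lim}):\operatorname{Lim}(q)\in D_J\}$, $J_{\mathrm C}(q)=\delta_J(\operatorname{Lim}(q))$. Coding and shift. $\tau(b)=\sum_{n\geq0}2b(n)3^{-(n+1)}$ for $b\in2^{\mathbb N}$; $\kappa(p)=\tau(0^{p(0)}1\,0^{p(1)}1\,0^{p(2)}1\cdots)$ for $p\in\mathbb N^{\mathbb N}$; $t(b)=\frac14+\frac18\tau(b)$; $\ell=\frac14$. Problems, $j\in\{\mathrm A,\mathrm B,\mathrm C\}$: $P_j$ has domain $D^H_j\times2^{\mathbb N}$ and relation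 $F_j(p,b)=t(b)+\ell Z(h_j(p))$; $Q_j$ has domain $D^J_j\times2^{\mathbb N}$ and relation $G_j(q,b)=t(b)+\ell J_j(q)$; outputs in $[0,1]$ with the usual metric and $\rho$. In all cases the evaluations are $\lambda_*(w,b)=\kappa(w)$ and $\lambda_n(w,b)=b(n)$ ($n\in\mathbb N$), real numbers with Cauchy names, indexed effectively ($*$ by $0$, $n$ by $n+1$). The full evaluation table is injective; the domain is represented by product-Cauchy names of the table. Transports. For problems $S,P$ of the form (relation $F:\Omega\rightrightarrows M$ with nonempty values, metric space $M$, indexed evaluations $\Lambda$): $S\leq^{\mathrm{mv}}_{\mathrm{raw},\mathrm{fq}}P$ if there are a map $E:\Omega_S\to\Omega_P$, a total continuous $D:M_P\to M_S$, and, for each indexed evaluation $\lambda_e\in\Lambda_P$, a finite list (depending only on $e$) of evaluations $\gamma_{i(e,1)},\dots,\gamma_{i(e,m_e)}\in\Lambda_S$ and a map $\vartheta_e$ on their transcript image such that for all $x\in\Omega_S$: $\varnothing\neq D[F_P(E(x))]\subseteq F_S(x)$ and $\lambda_e(E(x))=\vartheta_e(\gamma_{i(e,1)}(x),\dots,\gamma_{i(e,m_e)}(x))$. $S\leq^{\mathrm{mv}}_{\mathrm{TTE},\mathrm{fq}}P$ if in addition $E,D$ have computable realizers and a single computable procedure, given $e$, produces the index list and an index of a partial computable (on names) reconstruction whose domain contains the transcript image and which satisfies the second identity. *)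

theory Defs
  imports "HOL-Analysis.Analysis" "HOL-Library.Nat_Bijection" "HOL-Library.FuncSet"
begin

section \<open>Type-2 computability\<close>

type_synonym baire = "nat \<Rightarrow> nat"
type_synonym cantor = "nat \<Rightarrow> bool"

text \<open>
  Partial recursive functions relative to an oracle \<open>p \<in> \<nat>\<^sup>\<nat>\<close>. A partial function on Baire space is
  computable iff one program computes, with the argument \<open>p\<close> as oracle, every digit of the value.
\<close>

datatype prog =
    Zero
  | Succ
  | Proj nat
  | Query
  | Comp prog "prog list"
  | PrimRec prog prog
  | Mu prog

primrec run :: "prog \<Rightarrow> baire \<Rightarrow> nat list \<Rightarrow> nat option" where
  "run Zero p xs = Some 0"
| "run Succ p xs = (case xs of [] \<Rightarrow> None | x # _ \<Rightarrow> Some (Suc x))"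
| "run (Proj i) p xs = (if i < length xs then Some (xs ! i) else None)"
| "run Query p xs = (case xs of [] \<Rightarrow> None | x # _ \<Rightarrow> Some (p x))"
| "run (Comp f gs) p xs = Option.bind (those (map (\<lambda>g. run g p xs) gs)) (run f p)"
| "run (PrimRec f g) p xs = (case xs of [] \<Rightarrow> None
    | n # ys \<Rightarrow> rec_nat (run f p ys) (\<lambda>m r. Option.bind r (\<lambda>y. run g p (m # y # ys))) n)"
| "run (Mu f) p xs =
    (if \<exists>n. run f p (n # xs) = Some 0 \<and> (\<forall>m<n. \<exists>k. run f p (m # xs) = Some (Suc k))
     then Some (LEAST n. run f p (n # xs) = Some 0) else None)"

primrec code :: "prog \<Rightarrow> nat" where
  "code Zero = prod_encode (0, 0)"
| "code Succ = prod_encode (1, 0)"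
| "code (Proj i) = prod_encode (2, i)"
| "code Query = prod_encode (3, 0)"
| "code (Comp f gs) = prod_encode (4, prod_encode (code f, list_encode (map code gs)))"
| "code (PrimRec f g) = prod_encode (5, prod_encode (code f, code g))"
| "code (Mu f) = prod_encode (6, code f)"

lemma code_eq_iff: "code f = code g \<longleftrightarrow> f = g"
proof
  show "code f = code g \<Longrightarrow> f = g"
  proof (induction f arbitrary: g)
    case (Comp f gs)
    obtain f' gs' where g: "g = Comp f' gs'" "code f = code f'" "map code gs = map code gs'"
      using Comp.prems by (cases g) (simp_all add: list_encode_eq)
    have "gs = gs'"
    proof (rule nth_equalityI)
      show len: "length gs = length gs'" using map_eq_imp_length_eq[OF g(3)] .
      fix i assume i: "i < length gs"
      then have "code (gs ! i) = code (gs' ! i)"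
        using arg_cong[OF g(3), of "\<lambda>l. l ! i"] len by simp
      then show "gs ! i = gs' ! i" by (rule Comp.IH(2)[OF nth_mem[OF i]])
    qed
    with g(1) Comp.IH(1)[OF g(2)] show ?case by simp
  next
    case (PrimRec f f')
    obtain k k' where g: "g = PrimRec k k'" "code f = code k" "code f' = code k'"
      using PrimRec.prems by (cases g) simp_all
    with PrimRec.IH(1)[OF g(2)] PrimRec.IH(2)[OF g(3)] show ?case by simp
  next
    case (Mu f)
    obtain k where g: "g = Mu k" "code f = code k"
      using Mu.prems by (cases g) simp_all
    with Mu.IH[OF g(2)] show ?case by simp
  next
    case Zero
    then show ?case by (cases g) simp_all
  next
    case Succ
    then show ?case by (cases g) simp_all
  next
    case (Proj i)
    then show ?case by (cases g) simp_all
  next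
    case Query
    then show ?case by (cases g) simp_all
  qed
qed simp

definition computes :: "prog \<Rightarrow> baire \<Rightarrow> baire \<Rightarrow> bool" where
  "computes r p q \<longleftrightarrow> (\<forall>n. run r p [n] = Some (q n))"

definition computable_nat :: "(nat \<Rightarrow> nat) \<Rightarrow> bool" where
  "computable_nat g \<longleftrightarrow> (\<exists>r. \<forall>n. run r (\<lambda>_. 0) [n] = Some (g n))"

section \<open>Representations\<close>

text \<open>
  A naming relation \<open>R p x\<close> says that \<open>p\<close> is a name of \<open>x\<close>; a program realizes \<open>f\<close> on \<open>X\<close> if it
  sends every name of every \<open>x \<in> X\<close> to some name of \<open>f x\<close>.
\<close>

definition realizes ::
    "prog \<Rightarrow> (baire \<Rightarrow> 'x \<Rightarrow> bool) \<Rightarrow> (baire \<Rightarrow> 'y \<Rightarrow> bool) \<Rightarrow> 'x set \<Rightarrow> ('x \<Rightarrow> 'y) \<Rightarrow> bool" where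
  "realizes r R R' X f \<longleftrightarrow> (\<forall>x\<in>X. \<forall>p. R p x \<longrightarrow> (\<exists>q. computes r p q \<and> R' q (f x)))"

definition rep_dom :: "(baire \<Rightarrow> 'x \<Rightarrow> bool) \<Rightarrow> 'x set \<Rightarrow> baire set" where
  "rep_dom R X = {p. \<exists>x\<in>X. R p x}"

definition rep :: "(baire \<Rightarrow> 'x \<Rightarrow> bool) \<Rightarrow> 'x set \<Rightarrow> baire \<Rightarrow> 'x" where
  "rep R X p = (THE x. x \<in> X \<and> R p x)"

definition rat_of_code :: "nat \<Rightarrow> real" where
  "rat_of_code n = (case prod_decode n of (a, b) \<Rightarrow> real_of_int (int_decode a) / real (Suc b))"

definition cauchy_name :: "baire \<Rightarrow> real \<Rightarrow> bool" where
  "cauchy_name p x \<longleftrightarrow> (\<forall>j. \<bar>rat_of_code (p j) - x\<bar> \<le> (1/2) ^ j)"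

definition col_of :: "baire \<Rightarrow> nat \<Rightarrow> baire" where
  "col_of p e = (\<lambda>k. p (prod_encode (e, k)))"

definition tuple_name :: "baire \<Rightarrow> real list \<Rightarrow> bool" where
  "tuple_name p xs \<longleftrightarrow> (\<forall>i<length xs. cauchy_name (col_of p i) (xs ! i))"

definition pair :: "baire \<Rightarrow> baire \<Rightarrow> baire" where
  "pair u v = (\<lambda>n. if even n then u (n div 2) else v (n div 2))"

definition pair_fst :: "baire \<Rightarrow> baire" where
  "pair_fst w = (\<lambda>n. w (2 * n))"

definition limB_dom :: "baire set" where
  "limB_dom = {P. \<forall>j. \<exists>c. \<forall>\<^sub>F s in sequentially. P (prod_encode (s, j)) = c}"

definition limB :: "baire \<Rightarrow> baire" where
  "limB P = (\<lambda>j. THE c. \<forall>\<^sub>F s in sequentially. P (prod_encode (s, j)) = c)"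

section \<open>Names of continuous functions\<close>

text \<open>
  A rational polygonal function on \<open>[0,1]\<close> is given by its list of vertices, whose abscissae
  increase strictly from \<open>0\<close> to \<open>1\<close>.
\<close>

definition vertices_of_code :: "nat \<Rightarrow> (real \<times> real) list" where
  "vertices_of_code n = map (\<lambda>m. map_prod rat_of_code rat_of_code (prod_decode m)) (list_decode n)"

definition valid_vertices :: "(real \<times> real) list \<Rightarrow> bool" where
  "valid_vertices vs \<longleftrightarrow> vs \<noteq> [] \<and> fst (hd vs) = 0 \<and> fst (last vs) = 1 \<and> sorted_wrt (<) (map fst vs)"

fun polygon :: "(real \<times> real) list \<Rightarrow> real \<Rightarrow> real" where
  "polygon [] t = 0"
| "polygon [(x, y)] t = y"
| "polygon ((x0, y0) # (x1, y1) # vs) t =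
    (if t \<le> x1 then y0 + (t - x0) / (x1 - x0) * (y1 - y0) else polygon ((x1, y1) # vs) t)"

text \<open>
  Elements of \<open>C([0,1],\<real>)\<close> are taken extensional (\<open>undefined\<close> off \<open>[0,1]\<close>), so that a function on
  \<open>[0,1]\<close> is a single HOL object and names determine what they name.
\<close>

definition C01 :: "(real \<Rightarrow> real) set" where
  "C01 = {h \<in> extensional {0..1}. continuous_on {0..1} h}"

definition C_name :: "baire \<Rightarrow> (real \<Rightarrow> real) \<Rightarrow> bool" where
  "C_name p h \<longleftrightarrow> (\<forall>n. valid_vertices (vertices_of_code (p n)) \<and>
      (\<forall>x\<in>{0..1}. \<bar>polygon (vertices_of_code (p n)) x - h x\<bar> \<le> (1/2) ^ n))"

definition zeros :: "(real \<Rightarrow> real) \<Rightarrow> real set" where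
  "zeros h = {x \<in> {0..1}. h x = 0}"

definition HH :: "(real \<Rightarrow> real) set" where
  "HH = {h \<in> C01. h 0 < 0 \<and> 0 < h 1 \<and> zeros h \<subseteq> {1/3..2/3}}"

abbreviation "D_H \<equiv> rep_dom C_name HH"
abbreviation "\<delta>_H \<equiv> rep C_name HH"

section \<open>Negative names of closed intervals\<close>

text \<open>Codes \<open>(a, b)\<close> with \<open>b \<le> a\<close> denote the empty set and serve as padding.\<close>

definition interval_of_code :: "nat \<Rightarrow> real set" where
  "interval_of_code n = (case prod_decode n of (a, b) \<Rightarrow>
      {rat_of_code a <..< rat_of_code b} \<inter> {0..1})"

definition neg_name :: "baire \<Rightarrow> real set \<Rightarrow> bool" where
  "neg_name p J \<longleftrightarrow> (\<Union>n. interval_of_code (p n)) = {0..1} - J"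

definition JJ :: "real set set" where
  "JJ = {{a..b} | a b. 1/3 \<le> a \<and> a \<le> b \<and> b \<le> 2/3}"

abbreviation "D_J \<equiv> rep_dom neg_name JJ"
abbreviation "\<delta>_J \<equiv> rep neg_name JJ"

section \<open>Payload domains and maps\<close>

definition DH_A :: "baire set" where
  "DH_A = {pair u v | u v. u \<in> D_H \<and> (\<exists>x\<in>zeros (\<delta>_H u). cauchy_name v x)}"
definition h_A :: "baire \<Rightarrow> real \<Rightarrow> real" where "h_A w = \<delta>_H (pair_fst w)"

definition DH_B :: "baire set" where "DH_B = D_H"
definition h_B :: "baire \<Rightarrow> real \<Rightarrow> real" where "h_B u = \<delta>_H u"

definition DH_C :: "baire set" where "DH_C = {p \<in> limB_dom. limB p \<in> D_H}"
definition h_C :: "baire \<Rightarrow> real \<Rightarrow> real" where "h_C p = \<delta>_H (limB p)"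

definition DJ_A :: "baire set" where
  "DJ_A = {pair q v | q v. q \<in> D_J \<and> (\<exists>x\<in>\<delta>_J q. cauchy_name v x)}"
definition J_A :: "baire \<Rightarrow> real set" where "J_A w = \<delta>_J (pair_fst w)"

definition DJ_B :: "baire set" where "DJ_B = D_J"
definition J_B :: "baire \<Rightarrow> real set" where "J_B q = \<delta>_J q"

definition DJ_C :: "baire set" where "DJ_C = {q \<in> limB_dom. limB q \<in> D_J}"
definition J_C :: "baire \<Rightarrow> real set" where "J_C q = \<delta>_J (limB q)"

section \<open>Coding and shift\<close>

definition \<tau> :: "cantor \<Rightarrow> real" where
  "\<tau> b = (\<Sum>n. 2 * of_bool (b n) / 3 ^ (n + 1))"

text \<open>
  The word \<open>0\<^bsup>p(0)\<^esup> 1 0\<^bsup>p(1)\<^esup> 1 \<dots>\<close>, given by the positions of its ones;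
  see \<open>unary_word_prefix\<close>.
\<close>

definition unary_word :: "baire \<Rightarrow> cantor" where
  "unary_word p n \<longleftrightarrow> (\<exists>k. n = (\<Sum>i\<le>k. p i) + k)"

definition \<kappa> :: "baire \<Rightarrow> real" where
  "\<kappa> p = \<tau> (unary_word p)"

definition shift :: "cantor \<Rightarrow> real" where
  "shift b = 1/4 + 1/8 * \<tau> b"

definition ell :: real where
  "ell = 1/4"

section \<open>Problems and transports\<close>

text \<open>
  The output space is a subset of a metric space with the induced metric, together with a naming
  relation; evaluations are indexed by natural numbers.
\<close>

record ('x, 'm) sci_problem =
  instances :: "'x set"
  outputs :: "'m set"
  out_name :: "baire \<Rightarrow> 'm \<Rightarrow> bool"
  solutions :: "'x \<Rightarrow> 'm set"
  evaluation :: "nat \<Rightarrow> 'x \<Rightarrow> real"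

definition transcript :: "('x, 'm) sci_problem \<Rightarrow> nat list \<Rightarrow> 'x \<Rightarrow> real list" where
  "transcript S is x = map (\<lambda>i. evaluation S i x) is"

definition table_name :: "('x, 'm) sci_problem \<Rightarrow> baire \<Rightarrow> 'x \<Rightarrow> bool" where
  "table_name S p x \<longleftrightarrow> (\<forall>e. cauchy_name (col_of p e) (evaluation S e x))"

definition raw_fq_transport ::
    "('x, 'm::metric_space) sci_problem \<Rightarrow> ('y, 'n::metric_space) sci_problem
      \<Rightarrow> ('x \<Rightarrow> 'y) \<Rightarrow> ('n \<Rightarrow> 'm) \<Rightarrow> bool" where
  "raw_fq_transport S P E D \<longleftrightarrow>
     E \<in> instances S \<rightarrow> instances P \<and>
     D \<in> outputs P \<rightarrow> outputs S \<and> continuous_on (outputs P) D \<and>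
     (\<forall>x\<in>instances S. D ` solutions P (E x) \<noteq> {} \<and> D ` solutions P (E x) \<subseteq> solutions S x) \<and>
     (\<forall>e. \<exists>is \<theta>. \<forall>x\<in>instances S. evaluation P e (E x) = \<theta> (transcript S is x))"

text \<open>
  The computable \<open>g\<close> sends \<open>e\<close> to the list of queried evaluations and the code of a program that
  realizes a partial reconstruction \<open>\<theta> :\<subseteq> \<real>\<^sup>m \<rightarrow> \<real>\<close> defined on the transcript image.
\<close>

definition effective_queries ::
    "('x, 'm) sci_problem \<Rightarrow> ('y, 'n) sci_problem \<Rightarrow> ('x \<Rightarrow> 'y) \<Rightarrow> bool" where
  "effective_queries S P E \<longleftrightarrow> (\<exists>g. computable_nat g \<and>
     (\<forall>e. \<exists>is r \<theta>. g e = prod_encode (list_encode is, code r) \<and>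
        dom \<theta> \<subseteq> {xs. length xs = length is} \<and>
        transcript S is ` instances S \<subseteq> dom \<theta> \<and>
        realizes r tuple_name cauchy_name (dom \<theta>) (the \<circ> \<theta>) \<and>
        (\<forall>x\<in>instances S. \<theta> (transcript S is x) = Some (evaluation P e (E x)))))"

definition raw_fq_le ::
    "('x, 'm::metric_space) sci_problem \<Rightarrow> ('y, 'n::metric_space) sci_problem \<Rightarrow> bool"
    (infix "\<le>raw'_fq" 50) where
  "S \<le>raw_fq P \<longleftrightarrow> (\<exists>E D. raw_fq_transport S P E D)"

definition TTE_fq_le ::
    "('x, 'm::metric_space) sci_problem \<Rightarrow> ('y, 'n::metric_space) sci_problem \<Rightarrow> bool"
    (infix "\<le>TTE'_fq" 50) where
  "S \<le>TTE_fq P \<longleftrightarrow> (\<exists>E D. raw_fq_transport S P E D \<and>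
     (\<exists>r. realizes r (table_name S) (table_name P) (instances S) E) \<and>
     (\<exists>r. realizes r (out_name P) (out_name S) (outputs P) D) \<and>
     effective_queries S P E)"

section \<open>The six problems\<close>

text \<open>Index \<open>0\<close> is the payload evaluation \<open>\<lambda>\<^sub>*\<close>, index \<open>n + 1\<close> the bit evaluation \<open>\<lambda>\<^sub>n\<close>.\<close>

definition payload_eval :: "nat \<Rightarrow> baire \<times> cantor \<Rightarrow> real" where
  "payload_eval e x = (case e of 0 \<Rightarrow> \<kappa> (fst x) | Suc n \<Rightarrow> of_bool (snd x n))"

definition shifted_problem :: "baire set \<Rightarrow> (baire \<Rightarrow> real set) \<Rightarrow> (baire \<times> cantor, real) sci_problem" where
  "shifted_problem W A = \<lparr>
     instances = W \<times> UNIV,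
     outputs = {0..1},
     out_name = cauchy_name,
     solutions = (\<lambda>(w, b). (\<lambda>x. shift b + ell * x) ` A w),
     evaluation = payload_eval\<rparr>"

definition "P_A = shifted_problem DH_A (\<lambda>w. zeros (h_A w))"
definition "P_B = shifted_problem DH_B (\<lambda>w. zeros (h_B w))"
definition "P_C = shifted_problem DH_C (\<lambda>w. zeros (h_C w))"
definition "Q_A = shifted_problem DJ_A J_A"
definition "Q_B = shifted_problem DJ_B J_B"
definition "Q_C = shifted_problem DJ_C J_C"

section \<open>Well-definedness\<close>

lemma unary_word_prefix:
  "map (unary_word p) [0..<\<Sum>i<k. Suc (p i)] = concat (map (\<lambda>i. replicate (p i) False @ [True]) [0..<k])"
proof (induction k)
  case (Suc k)
  let ?N = "\<Sum>i<k. Suc (p i)"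
  have N: "?N = (\<Sum>i<k. p i) + k" by (induction k) auto
  have zero: "\<not> unary_word p (?N + i)" if "i < p k" for i
  proof
    assume "unary_word p (?N + i)"
    then obtain l where l: "(\<Sum>i<k. p i) + k + i = (\<Sum>i\<le>l. p i) + l"
      unfolding unary_word_def N by auto
    show False
    proof (cases "l < k")
      case True
      then have "(\<Sum>i\<le>l. p i) \<le> (\<Sum>i<k. p i)" by (intro sum_mono2) auto
      then show False using l True by linarith
    next
      case False
      then have "(\<Sum>i\<le>k. p i) \<le> (\<Sum>i\<le>l. p i)" by (intro sum_mono2) auto
      moreover have "(\<Sum>i\<le>k. p i) = (\<Sum>i<k. p i) + p k"
        by (simp add: lessThan_Suc_atMost[symmetric])
      ultimately show False using l False that by linarith
    qed
  qed
  have one: "unary_word p (?N + p k)"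
    unfolding unary_word_def N by (intro exI[of _ k]) (simp add: lessThan_Suc_atMost[symmetric])
  have "map (unary_word p) [?N..<?N + p k] = replicate (p k) False"
    using zero by (intro nth_equalityI) auto
  moreover have "[0..<\<Sum>i<Suc k. Suc (p i)] = [0..<?N] @ [?N..<?N + p k] @ [?N + p k]"
    using upt_add_eq_append[of 0 ?N "p k"] by simp
  moreover have "map (unary_word p) [?N + p k] = [True]" using one by simp
  ultimately show ?case by (simp only: map_append Suc.IH) simp
qed simp

lemma inj_unary_word: "inj unary_word"
proof (rule injI, rule ccontr)
  fix p q :: baire assume eq: "unary_word p = unary_word q" and "p \<noteq> q"
  define k where "k = (LEAST k. p k \<noteq> q k)"
  have ne: "p k \<noteq> q k" and le: "\<And>i. i < k \<Longrightarrow> p i = q i"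
    unfolding k_def using \<open>p \<noteq> q\<close> LeastI_ex[of "\<lambda>k. p k \<noteq> q k"] not_less_Least by blast+
  have *: False
    if eq: "unary_word p = unary_word q" and le: "\<And>i. i < k \<Longrightarrow> p i = q i" and lt: "p k < q k" for p q
  proof -
    have "unary_word q ((\<Sum>i\<le>k. p i) + k)"
      unfolding eq[symmetric] by (auto simp: unary_word_def)
    then obtain l where l: "(\<Sum>i\<le>k. p i) + k = (\<Sum>i\<le>l. q i) + l" by (auto simp: unary_word_def)
    have s: "(\<Sum>i\<le>k. f i) = (\<Sum>i<k. f i) + f k" for f :: baire
      by (simp add: lessThan_Suc_atMost[symmetric])
    have e: "(\<Sum>i<k. p i) = (\<Sum>i<k. q i)" using le by (intro sum.cong) auto
    show False
    proof (cases "l < k")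
      case True
      then have "(\<Sum>i\<le>l. q i) \<le> (\<Sum>i<k. q i)" by (intro sum_mono2) auto
      then show False using l True s[of p] e by linarith
    next
      case False
      then have "(\<Sum>i\<le>k. q i) \<le> (\<Sum>i\<le>l. q i)" by (intro sum_mono2) auto
      then show False using l False s[of p] s[of q] e lt by linarith
    qed
  qed
  show False
    using ne *[of p q] *[of q p] eq le by (metis linorder_neqE_nat)
qed

lemma summable_tau: "summable (\<lambda>n. 2 * of_bool (b n) / (3::real) ^ (n + 1))"
proof (rule summable_comparison_test')
  show "summable (\<lambda>n. 2/3 * (1/3::real) ^ n)" by (intro summable_mult summable_geometric) auto
  show "norm (2 * of_bool (b n) / (3::real) ^ (n + 1)) \<le> 2/3 * (1/3) ^ n" for n
    by (auto simp: power_one_over field_simps)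
qed

lemma tau_bounds: "0 \<le> \<tau> b" "\<tau> b \<le> 1"
proof -
  show "0 \<le> \<tau> b" unfolding \<tau>_def by (intro suminf_nonneg summable_tau) auto
  have "\<tau> b \<le> (\<Sum>n. 2/3 * (1/3::real) ^ n)"
    unfolding \<tau>_def
    by (intro suminf_le summable_tau summable_mult summable_geometric)
      (auto simp: power_one_over field_simps)
  also have "\<dots> = 1" by (subst suminf_mult) (auto simp: suminf_geometric intro!: summable_geometric)
  finally show "\<tau> b \<le> 1" .
qed

lemma tau_Suc: "\<tau> b = 2 / 3 * of_bool (b 0) + \<tau> (\<lambda>n. b (Suc n)) / 3"
proof -
  have "\<tau> b = (\<Sum>n. 2 * of_bool (b (Suc n)) / (3::real) ^ (Suc n + 1)) + 2 * of_bool (b 0) / 3"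
    unfolding \<tau>_def using suminf_split_head[OF summable_tau[of b]] by simp
  also have "(\<Sum>n. 2 * of_bool (b (Suc n)) / (3::real) ^ (Suc n + 1)) = \<tau> (\<lambda>n. b (Suc n)) / 3"
    unfolding \<tau>_def by (subst suminf_divide[OF summable_tau, symmetric]) (simp add: field_simps)
  finally show ?thesis by simp
qed

lemma inj_tau: "inj \<tau>"
proof (rule injI, rule ext)
  fix b c :: cantor and n assume "\<tau> b = \<tau> c"
  then show "b n = c n"
  proof (induction n arbitrary: b c)
    case 0
    then show ?case
      using tau_Suc[of b] tau_Suc[of c] tau_bounds[of "\<lambda>n. b (Suc n)"] tau_bounds[of "\<lambda>n. c (Suc n)"]
      by (auto simp: of_bool_def split: if_splits)
  next
    case (Suc n)
    have "b 0 = c 0"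
      using Suc.prems tau_Suc[of b] tau_Suc[of c]
        tau_bounds[of "\<lambda>n. b (Suc n)"] tau_bounds[of "\<lambda>n. c (Suc n)"]
      by (auto simp: of_bool_def split: if_splits)
    then have "\<tau> (\<lambda>n. b (Suc n)) = \<tau> (\<lambda>n. c (Suc n))"
      using Suc.prems tau_Suc[of b] tau_Suc[of c] by simp
    then show ?case using Suc.IH by blast
  qed
qed

lemma inj_kappa: "inj \<kappa>"
  using inj_compose[OF inj_tau inj_unary_word] unfolding \<kappa>_def comp_def .

lemma inj_table: "inj (\<lambda>x e. payload_eval e x)"
proof (rule injI)
  fix x y assume eq: "(\<lambda>e. payload_eval e x) = (\<lambda>e. payload_eval e y)"
  have "\<kappa> (fst x) = \<kappa> (fst y)" using fun_cong[OF eq, of 0] by (simp add: payload_eval_def)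
  moreover have "snd x n = snd y n" for n
    using fun_cong[OF eq, of "Suc n"] by (auto simp: payload_eval_def split: if_splits)
  ultimately show "x = y" using inj_kappa by (auto simp: prod_eq_iff inj_def)
qed

lemma limB_eqI:
  assumes "\<And>j. \<forall>\<^sub>F s in sequentially. P (prod_encode (s, j)) = q j" shows "limB P = q"
proof
  fix j
  have "c = q j" if "\<forall>\<^sub>F s in sequentially. P (prod_encode (s, j)) = c" for c
    using eventually_happens'[OF sequentially_bot eventually_conj[OF assms[of j] that]] by auto
  then show "limB P j = q j" unfolding limB_def by (intro the_equality assms)
qed

lemma pair_fst_pair [simp]: "pair_fst (pair u v) = u"
  by (simp add: pair_fst_def pair_def)

lemma pair_inject: "pair u v = pair u' v' \<longleftrightarrow> u = u' \<and> v = v'"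
proof
  assume eq: "pair u v = pair u' v'"
  have "u n = u' n" "v n = v' n" for n
    using fun_cong[OF eq, of "2 * n"] fun_cong[OF eq, of "2 * n + 1"] by (simp_all add: pair_def)
  then show "u = u' \<and> v = v'" by blast
qed auto

lemma cauchy_name_unique:
  assumes "cauchy_name p x" "cauchy_name p y" shows "x = y"
proof (rule LIMSEQ_unique)
  have *: "(\<lambda>j. rat_of_code (p j)) \<longlonglongrightarrow> z" if "cauchy_name p z" for z
    by (rule LIM_zero_cancel, rule tendsto_rabs_zero_cancel,
        rule tendsto_sandwich[OF _ _ tendsto_const LIMSEQ_power_zero[of "1/2::real"]])
      (use that in \<open>auto simp: cauchy_name_def\<close>)
  show "(\<lambda>j. rat_of_code (p j)) \<longlonglongrightarrow> x" "(\<lambda>j. rat_of_code (p j)) \<longlonglongrightarrow> y" using * assms by auto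
qed

lemma C_name_unique:
  assumes "C_name p h" "C_name p h'" "h \<in> C01" "h' \<in> C01" shows "h = h'"
proof (rule extensionalityI[of _ "{0..1}"])
  show "h \<in> extensional {0..1}" "h' \<in> extensional {0..1}" using assms by (auto simp: C01_def)
  fix x :: real assume x: "x \<in> {0..1}"
  have *: "(\<lambda>n. polygon (vertices_of_code (p n)) x) \<longlonglongrightarrow> g x" if "C_name p g" for g
    by (rule LIM_zero_cancel, rule tendsto_rabs_zero_cancel,
        rule tendsto_sandwich[OF _ _ tendsto_const LIMSEQ_power_zero[of "1/2::real"]])
      (use that x in \<open>auto simp: C_name_def\<close>)
  show "h x = h' x" using *[OF assms(1)] *[OF assms(2)] by (rule LIMSEQ_unique)
qed

lemma neg_name_unique:
  "neg_name p J \<Longrightarrow> neg_name p J' \<Longrightarrow> J \<subseteq> {0..1} \<Longrightarrow> J' \<subseteq> {0..1} \<Longrightarrow> J = J'"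
  unfolding neg_name_def by (metis double_diff subset_refl)

lemma JJ_subset: "J \<in> JJ \<Longrightarrow> J \<subseteq> {0..1}"
  unfolding JJ_def by auto

lemma rep_H:
  assumes "h \<in> HH" "C_name p h" shows "\<delta>_H p = h"
  unfolding rep_def
proof (rule the_equality)
  fix g assume "g \<in> HH \<and> C_name p g"
  then show "g = h" using C_name_unique[of p g h] assms unfolding HH_def by blast
qed (use assms in blast)

lemma rep_J:
  assumes "J \<in> JJ" "neg_name p J" shows "\<delta>_J p = J"
  unfolding rep_def
proof (rule the_equality)
  fix K assume "K \<in> JJ \<and> neg_name p K"
  then show "K = J" using neg_name_unique[of p K J] JJ_subset assms by blast
qed (use assms in blast)

lemma rep_H_in: "u \<in> D_H \<Longrightarrow> \<delta>_H u \<in> HH"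
  unfolding rep_dom_def using rep_H by blast

lemma rep_J_in: "q \<in> D_J \<Longrightarrow> \<delta>_J q \<in> JJ"
  unfolding rep_dom_def using rep_J by blast

lemma zeros_nonempty: "h \<in> HH \<Longrightarrow> zeros h \<noteq> {}"
  using IVT'[of h 0 0 1] by (auto simp: HH_def C01_def zeros_def)

lemma shifted_problem_solutions:
  assumes "\<And>w. w \<in> W \<Longrightarrow> A w \<noteq> {} \<and> A w \<subseteq> {0..1}" "x \<in> instances (shifted_problem W A)"
  shows "solutions (shifted_problem W A) x \<noteq> {} \<and>
    solutions (shifted_problem W A) x \<subseteq> outputs (shifted_problem W A)"
proof -
  obtain w b where x: "x = (w, b)" "w \<in> W" using assms(2) by (auto simp: shifted_problem_def)
  have "shift b + ell * y \<in> {0..1}" if "y \<in> A w" for y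
  proof -
    have "y \<in> {0..1}" using assms(1)[OF x(2)] that by auto
    then show ?thesis using tau_bounds[of b] by (auto simp: shift_def ell_def)
  qed
  then show ?thesis using assms(1)[OF x(2)] x by (auto simp: shifted_problem_def)
qed

lemma solutions_nonempty:
  assumes "P \<in> {P_A, Q_A, P_B, Q_B, P_C, Q_C}" "x \<in> instances P"
  shows "solutions P x \<noteq> {} \<and> solutions P x \<subseteq> outputs P"
proof -
  have H: "zeros h \<noteq> {} \<and> zeros h \<subseteq> {0..1}" if "h \<in> HH" for h
    using that zeros_nonempty by (auto simp: zeros_def)
  have J: "J \<noteq> {} \<and> J \<subseteq> {0..1}" if "J \<in> JJ" for J
    using that JJ_subset[OF that] by (auto simp: JJ_def)
  from assms(1) consider "P = P_A" | "P = P_B" | "P = P_C" | "P = Q_A" | "P = Q_B" | "P = Q_C"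
    by blast
  then show ?thesis
  proof cases
    case 1
    have "zeros (h_A w) \<noteq> {} \<and> zeros (h_A w) \<subseteq> {0..1}" if "w \<in> DH_A" for w
      using that by (intro H) (auto simp: DH_A_def h_A_def rep_H_in)
    from shifted_problem_solutions[OF this] show ?thesis
      using assms(2) unfolding 1 P_A_def by simp
  next
    case 2
    have "zeros (h_B w) \<noteq> {} \<and> zeros (h_B w) \<subseteq> {0..1}" if "w \<in> DH_B" for w
      using that by (intro H) (auto simp: DH_B_def h_B_def rep_H_in)
    from shifted_problem_solutions[OF this] show ?thesis
      using assms(2) unfolding 2 P_B_def by simp
  next
    case 3
    have "zeros (h_C w) \<noteq> {} \<and> zeros (h_C w) \<subseteq> {0..1}" if "w \<in> DH_C" for w
      using that by (intro H) (auto simp: DH_C_def h_C_def rep_H_in)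
    from shifted_problem_solutions[OF this] show ?thesis
      using assms(2) unfolding 3 P_C_def by simp
  next
    case 4
    have "J_A w \<noteq> {} \<and> J_A w \<subseteq> {0..1}" if "w \<in> DJ_A" for w
      using that by (intro J) (auto simp: DJ_A_def J_A_def rep_J_in)
    from shifted_problem_solutions[OF this] show ?thesis
      using assms(2) unfolding 4 Q_A_def by simp
  next
    case 5
    have "J_B w \<noteq> {} \<and> J_B w \<subseteq> {0..1}" if "w \<in> DJ_B" for w
      using that by (intro J) (auto simp: DJ_B_def J_B_def rep_J_in)
    from shifted_problem_solutions[OF this] show ?thesis
      using assms(2) unfolding 5 Q_B_def by simp
  next
    case 6
    have "J_C w \<noteq> {} \<and> J_C w \<subseteq> {0..1}" if "w \<in> DJ_C" for w
      using that by (intro J) (auto simp: DJ_C_def J_C_def rep_J_in)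
    from shifted_problem_solutions[OF this] show ?thesis
      using assms(2) unfolding 6 Q_C_def by simp
  qed
qed

end

theory Submission
  imports Defs
begin

text \<open>
  The output map is the identity throughout, and the bit part \<open>b\<close> of an instance is copied, so a
  transport amounts to a map of payloads \<open>w \<mapsto> w'\<close> whose solution set \<open>A' w'\<close> is a nonempty subset of
  \<open>A w\<close>. The common shift by \<open>b\<close> and scaling by \<open>\<ell>\<close> then carry this inclusion over to the problems.

  For the computable transports the payload map is in both cases a reindexing \<open>w \<mapsto> w \<circ> f\<close> with
  computable \<open>f\<close>: forgetting the second component of a pair is \<open>f n = 2 n\<close>, and presenting a name as the
  limit of a constant sequence is \<open>f \<langle>s, j\<rangle> = j\<close>. The work lies in showing that one can pass from a
  Cauchy name of \<open>\<kappa> w\<close> to one of \<open>\<kappa> (w \<circ> f)\<close> effectively. The Cantor set has gaps: once a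
  real in it is known closely enough, its leading ternary digits are determined
  (\<open>prefix_of_name_correct\<close>). So the binary word coding \<open>w\<close> can be read off bit by bit, and an unbounded
  search for the next bit \<open>1\<close> recovers every value of \<open>w\<close> (\<open>word_of_name_correct\<close>); the search succeeds
  because the word has infinitely many ones. Re-encoding a word is given by rational partial sums
  (\<open>cauchy_name_tau_code\<close>). A single program thus serves both as the reconstruction of the payload
  evaluation and as the payload column of the table realizer (\<open>shifted_problem_reindex\<close>).

  For the raw equivalences the reconstructions may be arbitrary functions. Since \<open>\<kappa>\<close> is injective, one query to the
  payload evaluation determines \<open>w\<close>, hence any function of \<open>w\<close>. It remains to find, for each \<open>w\<close>, some
  \<open>w'\<close> with \<open>A' w' \<subseteq> A w\<close>; every one of the six problems has nonempty solution sets inside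
  \<open>[1/3, 2/3]\<close> and admits each singleton of that interval as a solution set, so one chooses a point
  \<open>z \<in> A w\<close> and a payload \<open>w'\<close> with \<open>A' w' = {z}\<close> (\<open>raw_fq_le_if_attains_all_singletons\<close>).
\<close>

section \<open>Programs that are total on a set of oracles\<close>

text \<open>
  Totality is only asked for oracles in \<open>X\<close>: the decoding of \<open>\<kappa> w\<close> involves an unbounded search that
  terminates on names of such reals but not on arbitrary oracles.
\<close>

definition computable_on :: "baire set \<Rightarrow> nat \<Rightarrow> (baire \<Rightarrow> nat list \<Rightarrow> nat) \<Rightarrow> bool" where
  "computable_on X k F \<longleftrightarrow> (\<exists>r. \<forall>p\<in>X. \<forall>xs. length xs = k \<longrightarrow> run r p xs = Some (F p xs))"

named_theorems computable_intros "composition rules for computable_on"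

lemma computable_on_cong:
  assumes "computable_on X k F" "\<And>p xs. p \<in> X \<Longrightarrow> length xs = k \<Longrightarrow> F p xs = G p xs"
  shows "computable_on X k G"
  using assms unfolding computable_on_def by metis

lemma those_map_Some: "those (map (\<lambda>x. Some (f x)) xs) = Some (map f xs)"
  by (induction xs) auto

lemma computable_on_subst:
  assumes F: "computable_on X (length Gs) F" and Gs: "\<And>G. G \<in> set Gs \<Longrightarrow> computable_on X k G"
  shows "computable_on X k (\<lambda>p xs. F p (map (\<lambda>G. G p xs) Gs))"
proof -
  obtain r where r: "\<And>p xs. p \<in> X \<Longrightarrow> length xs = length Gs \<Longrightarrow> run r p xs = Some (F p xs)"
    using F unfolding computable_on_def by blast
  have "\<exists>R. \<forall>G\<in>set Gs. \<forall>p\<in>X. \<forall>xs. length xs = k \<longrightarrow> run (R G) p xs = Some (G p xs)"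
    using Gs unfolding computable_on_def by (intro bchoice) blast
  then obtain R where R: "\<And>G p xs. G \<in> set Gs \<Longrightarrow> p \<in> X \<Longrightarrow> length xs = k \<Longrightarrow>
      run (R G) p xs = Some (G p xs)" by blast
  have "run (Comp r (map R Gs)) p xs = Some (F p (map (\<lambda>G. G p xs) Gs))"
    if "p \<in> X" "length xs = k" for p xs
  proof -
    have "map (\<lambda>g. run g p xs) (map R Gs) = map (\<lambda>G. Some (G p xs)) Gs"
      using R that by simp
    then show ?thesis using r[OF that(1)] by (simp add: those_map_Some del: map_map)
  qed
  then show ?thesis unfolding computable_on_def by blast
qed

lemma computable_on_apply:
  assumes "computable_on X 1 (\<lambda>p xs. F p (xs ! 0))" "computable_on X k f"
  shows "computable_on X k (\<lambda>p xs. F p (f p xs))"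
  using computable_on_subst[of X "[f]" "\<lambda>p xs. F p (xs ! 0)" k] assms by simp

lemma computable_on_apply2:
  assumes "computable_on X 2 (\<lambda>p xs. F p (xs ! 0) (xs ! 1))"
    and "computable_on X k f" "computable_on X k g"
  shows "computable_on X k (\<lambda>p xs. F p (f p xs) (g p xs))"
  using computable_on_subst[of X "[f, g]" "\<lambda>p xs. F p (xs ! 0) (xs ! 1)" k] assms
  by (auto simp: numeral_2_eq_2)

lemma computable_on_nth [computable_intros]: "i < k \<Longrightarrow> computable_on X k (\<lambda>p xs. xs ! i)"
  unfolding computable_on_def by (intro exI[of _ "Proj i"]) simp

lemma computable_on_hd [computable_intros]: "computable_on X (Suc k) (\<lambda>p xs. hd xs)"
  by (rule computable_on_cong[OF computable_on_nth[of 0 "Suc k"]]) (auto simp: length_Suc_conv)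

lemma computable_on_nth_tl [computable_intros]:
  assumes "i < k" shows "computable_on X (Suc k) (\<lambda>p xs. tl xs ! i)"
  by (rule computable_on_cong[OF computable_on_nth[of "Suc i"]]) (use assms in \<open>auto simp: nth_tl\<close>)

text \<open>
  Rules for binders put the bound variable in front of the argument list, so parameters that do
  not mention it are shifted to the tail.
\<close>

lemma computable_on_tl:
  assumes "computable_on X k F" shows "computable_on X (Suc k) (\<lambda>p xs. F p (tl xs))"
proof -
  have "computable_on X (Suc k)
      (\<lambda>p xs. F p (map (\<lambda>G. G p xs) (map (\<lambda>i p xs. xs ! Suc i) [0..<k])))"
    using assms by (intro computable_on_subst) (auto intro!: computable_intros)
  then show ?thesis
  proof (rule computable_on_cong)
    fix p and xs :: "nat list" assume "length xs = Suc k"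
    then have "map ((!) xs \<circ> Suc) [0..<k] = tl xs"
      by (intro nth_equalityI) (auto simp: nth_tl)
    then show "F p (map (\<lambda>G. G p xs) (map (\<lambda>i p xs. xs ! Suc i) [0..<k])) = F p (tl xs)"
      by (simp add: comp_def)
  qed
qed

lemma computable_on_Suc [computable_intros]:
  assumes "computable_on X k f" shows "computable_on X k (\<lambda>p xs. Suc (f p xs))"
proof (rule computable_on_apply[OF _ assms])
  show "computable_on X 1 (\<lambda>p xs. Suc (xs ! 0))"
    unfolding computable_on_def by (intro exI[of _ Succ]) (auto simp: length_Suc_conv)
qed

lemma computable_on_oracle [computable_intros]:
  assumes "computable_on X k f" shows "computable_on X k (\<lambda>p xs. p (f p xs))"
proof (rule computable_on_apply[OF _ assms])
  show "computable_on X 1 (\<lambda>p xs. p (xs ! 0))"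
    unfolding computable_on_def by (intro exI[of _ Query]) (auto simp: length_Suc_conv)
qed

lemma computable_on_const [computable_intros]: "computable_on X k (\<lambda>p xs. c)"
proof (induction c)
  case 0
  show ?case unfolding computable_on_def by (intro exI[of _ Zero]) simp
qed (rule computable_on_Suc)

text \<open>
  The premise on \<open>G\<close> takes the list apart by \<open>hd\<close> and \<open>tl\<close>, which leaves \<open>G\<close> applied to distinct
  variables in the conclusion and makes the rule applicable by unification.
\<close>

lemma computable_on_rec_nat:
  assumes n: "computable_on X k n" and a: "computable_on X k a"
    and G: "computable_on X (Suc (Suc k)) (\<lambda>p ys. G p (hd ys) (hd (tl ys)) (tl (tl ys)))"
  shows "computable_on X k (\<lambda>p xs. rec_nat (a p xs) (\<lambda>m r. G p m r xs) (n p xs))"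
proof -
  obtain ra where ra: "\<And>p xs. p \<in> X \<Longrightarrow> length xs = k \<Longrightarrow> run ra p xs = Some (a p xs)"
    using a unfolding computable_on_def by blast
  obtain rg where "\<And>p ys. p \<in> X \<Longrightarrow> length ys = Suc (Suc k) \<Longrightarrow>
      run rg p ys = Some (G p (hd ys) (hd (tl ys)) (tl (tl ys)))"
    using G unfolding computable_on_def by blast
  then have rg: "run rg p (m # y # xs) = Some (G p m y xs)" if "p \<in> X" "length xs = k" for p m y xs
    using that by simp
  have run: "run (PrimRec ra rg) p (N # xs) = Some (rec_nat (a p xs) (\<lambda>m r. G p m r xs) N)"
    if "p \<in> X" "length xs = k" for p N xs
    by (induction N) (use that ra rg in auto)
  have "computable_on X (Suc k) (\<lambda>p ys. rec_nat (a p (tl ys)) (\<lambda>m r. G p m r (tl ys)) (hd ys))"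
    unfolding computable_on_def by (intro exI[of _ "PrimRec ra rg"])
      (auto simp: length_Suc_conv run simp del: run.simps)
  then have "computable_on X k (\<lambda>p xs. (\<lambda>p ys. rec_nat (a p (tl ys)) (\<lambda>m r. G p m r (tl ys)) (hd ys)) p
      (map (\<lambda>G. G p xs) (n # map (\<lambda>i p xs. xs ! i) [0..<k])))"
    using n by (intro computable_on_subst) (auto intro!: computable_intros)
  then show ?thesis
  proof (rule computable_on_cong)
    fix p and xs :: "nat list" assume "length xs = k"
    then have "map (\<lambda>i. xs ! i) [0..<k] = xs" using map_nth[of xs] by simp
    then show "(\<lambda>p ys. rec_nat (a p (tl ys)) (\<lambda>m r. G p m r (tl ys)) (hd ys)) p
        (map (\<lambda>G. G p xs) (n # map (\<lambda>i p xs. xs ! i) [0..<k])) =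
      rec_nat (a p xs) (\<lambda>m r. G p m r xs) (n p xs)"
      by (simp add: comp_def)
  qed
qed

lemma computable_on_Least:
  assumes P: "computable_on X (Suc k) (\<lambda>p ys. of_bool (\<not> P p (hd ys) (tl ys)))"
    and ex: "\<And>p xs. p \<in> X \<Longrightarrow> length xs = k \<Longrightarrow> \<exists>m. P p m xs"
  shows "computable_on X k (\<lambda>p xs. LEAST m. P p m xs)"
proof -
  obtain r where "\<And>p ys. p \<in> X \<Longrightarrow> length ys = Suc k \<Longrightarrow>
      run r p ys = Some (of_bool (\<not> P p (hd ys) (tl ys)))"
    using P unfolding computable_on_def by blast
  then have r: "run r p (m # xs) = Some (of_bool (\<not> P p m xs))" if "p \<in> X" "length xs = k" for p m xs
    using that by simp
  have "run (Mu r) p xs = Some (LEAST m. P p m xs)" if p: "p \<in> X" "length xs = k" for p xs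
  proof -
    define n where "n = (LEAST m. P p m xs)"
    have "P p n xs" "\<And>m. m < n \<Longrightarrow> \<not> P p m xs"
      unfolding n_def using ex[OF p] LeastI_ex[of "\<lambda>m. P p m xs"] not_less_Least by blast+
    then have "\<exists>n. P p n xs \<and> (\<forall>m<n. \<not> P p m xs)" by blast
    then show ?thesis by (simp add: r[OF p] of_bool_def) blast
  qed
  then show ?thesis unfolding computable_on_def by blast
qed

lemma computable_on_add [computable_intros]:
  assumes "computable_on X k f" "computable_on X k g"
  shows "computable_on X k (\<lambda>p xs. f p xs + g p xs)"
proof (rule computable_on_apply2[OF _ assms])
  have "computable_on X 2 (\<lambda>p xs. rec_nat (xs ! 0) (\<lambda>m r. Suc r) (xs ! 1))"
    by (intro computable_on_rec_nat computable_intros computable_on_tl) auto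
  moreover have "rec_nat a (\<lambda>m r. Suc r) b = a + b" for a b by (induction b) auto
  ultimately show "computable_on X 2 (\<lambda>p xs. xs ! 0 + xs ! 1)" by simp
qed

lemma computable_on_sum [computable_intros]:
  assumes "computable_on X k n" "computable_on X (Suc k) (\<lambda>p ys. G p (hd ys) (tl ys))"
  shows "computable_on X k (\<lambda>p xs. \<Sum>m<n p xs. G p m xs)"
proof -
  have G: "computable_on X (Suc (Suc k)) (\<lambda>p ys. G p (hd ys) (tl (tl ys)))"
  proof -
    have "computable_on X (Suc (Suc k)) (\<lambda>p ys. (\<lambda>p ys. G p (hd ys) (tl ys)) p
       (map (\<lambda>G. G p ys) ((\<lambda>p xs. hd xs) # map (\<lambda>i p xs. tl xs ! Suc i) [0..<k])))"
      using assms(2) by (intro computable_on_subst) (auto intro!: computable_intros)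
    then show ?thesis
    proof (rule computable_on_cong)
      fix p and xs :: "nat list" assume "length xs = Suc (Suc k)"
      then have "map (\<lambda>i. tl xs ! Suc i) [0..<k] = tl (tl xs)"
        by (intro nth_equalityI) (auto simp: nth_tl)
      then show "(\<lambda>p ys. G p (hd ys) (tl ys)) p
          (map (\<lambda>G. G p xs) ((\<lambda>p xs. hd xs) # map (\<lambda>i p xs. tl xs ! Suc i) [0..<k])) =
        G p (hd xs) (tl (tl xs))"
        by (simp add: comp_def)
    qed
  qed
  have "computable_on X k (\<lambda>p xs. rec_nat 0 (\<lambda>m r. r + G p m xs) (n p xs))"
    by (intro computable_on_rec_nat computable_intros assms(1) G computable_on_tl)
  moreover have "rec_nat 0 (\<lambda>m r. r + f m) n = (\<Sum>m<n. f m)" for f :: "nat \<Rightarrow> nat" and n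
    by (induction n) auto
  ultimately show ?thesis by simp
qed

lemma computable_on_diff [computable_intros]:
  assumes "computable_on X k f" "computable_on X k g"
  shows "computable_on X k (\<lambda>p xs. f p xs - g p xs)"
proof (rule computable_on_apply2[OF _ assms])
  \<comment> \<open>truncated subtraction iterates the predecessor, which is itself primitive recursive\<close>
  have "computable_on X 1 (\<lambda>p xs. rec_nat 0 (\<lambda>m r. m) (xs ! 0))"
    by (intro computable_on_rec_nat computable_intros) auto
  moreover have "rec_nat 0 (\<lambda>m r. m) a = a - 1" for a by (cases a) auto
  ultimately have "computable_on X 1 (\<lambda>p xs. xs ! 0 - 1)" by simp
  note pred = computable_on_apply[where F = "\<lambda>p a. a - 1", OF this]
  have "computable_on X 2 (\<lambda>p xs. rec_nat (xs ! 0) (\<lambda>m r. r - 1) (xs ! 1))"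
    by (intro computable_on_rec_nat computable_intros pred computable_on_tl) auto
  moreover have "rec_nat a (\<lambda>m r. r - 1) b = a - b" for a b :: nat by (induction b) auto
  ultimately show "computable_on X 2 (\<lambda>p xs. xs ! 0 - xs ! 1)" by simp
qed

lemma computable_on_mult [computable_intros]:
  assumes "computable_on X k f" "computable_on X k g"
  shows "computable_on X k (\<lambda>p xs. f p xs * g p xs)"
proof (rule computable_on_apply2[OF _ assms])
  have "computable_on X 2 (\<lambda>p xs. \<Sum>m<xs ! 0. xs ! 1)" by (intro computable_intros) auto
  then show "computable_on X 2 (\<lambda>p xs. xs ! 0 * xs ! 1)" by simp
qed

lemma computable_on_power [computable_intros]:
  assumes "computable_on X k f" shows "computable_on X k (\<lambda>p xs. c ^ f p xs)"
proof (rule computable_on_apply[OF _ assms])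
  have "computable_on X 1 (\<lambda>p xs. rec_nat 1 (\<lambda>m r. c * r) (xs ! 0))"
    by (intro computable_on_rec_nat computable_intros computable_on_tl) auto
  moreover have "rec_nat 1 (\<lambda>m r. c * r) a = c ^ a" for a by (induction a) auto
  ultimately show "computable_on X 1 (\<lambda>p xs. c ^ xs ! 0)" by simp
qed

lemma computable_on_not [computable_intros]:
  assumes "computable_on X k (\<lambda>p xs. of_bool (P p xs))"
  shows "computable_on X k (\<lambda>p xs. of_bool (\<not> P p xs))"
proof -
  have "computable_on X k (\<lambda>p xs. 1 - of_bool (P p xs))" by (intro computable_intros assms)
  then show ?thesis by (rule computable_on_cong) auto
qed

lemma computable_on_less [computable_intros]:
  assumes "computable_on X k f" "computable_on X k g"
  shows "computable_on X k (\<lambda>p xs. of_bool (f p xs < g p xs))"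
proof -
  have "computable_on X k (\<lambda>p xs. 1 - (Suc (f p xs) - g p xs))" by (intro computable_intros assms)
  then show ?thesis by (rule computable_on_cong) auto
qed

lemma computable_on_eq [computable_intros]:
  assumes "computable_on X k f" "computable_on X k g"
  shows "computable_on X k (\<lambda>p xs. of_bool (f p xs = g p xs))"
proof -
  have "computable_on X k (\<lambda>p xs. 1 - ((f p xs - g p xs) + (g p xs - f p xs)))"
    by (intro computable_intros assms)
  then show ?thesis by (rule computable_on_cong) auto
qed

lemma computable_on_if [computable_intros]:
  assumes "computable_on X k (\<lambda>p xs. of_bool (P p xs))" "computable_on X k f" "computable_on X k g"
  shows "computable_on X k (\<lambda>p xs. if P p xs then f p xs else g p xs)"
proof -
  have "computable_on X k (\<lambda>p xs. of_bool (P p xs) * f p xs + of_bool (\<not> P p xs) * g p xs)"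
    by (intro computable_intros assms)
  then show ?thesis by (rule computable_on_cong) auto
qed

lemma computable_on_div_Suc:
  assumes "computable_on X k f" "computable_on X k g"
  shows "computable_on X k (\<lambda>p xs. f p xs div Suc (g p xs))"
proof (rule computable_on_apply2[where F = "\<lambda>p a b. a div Suc b", OF _ assms])
  have div: "(LEAST q. a < Suc q * Suc b) = a div Suc b" for a b
  proof (rule Least_equality)
    show "a < Suc (a div Suc b) * Suc b"
      using dividend_less_div_times[of "Suc b" a] by simp
    fix q assume "a < Suc q * Suc b"
    then show "a div Suc b \<le> q" by (metis less_Suc_eq_le less_mult_imp_div_less)
  qed
  have "\<exists>q. a < Suc q * Suc b" for a b :: nat by (intro exI[of _ a]) simp
  then have "computable_on X 2 (\<lambda>p xs. LEAST q. xs ! 0 < Suc q * Suc (xs ! 1))"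
    by (intro computable_on_Least computable_intros) auto
  then show "computable_on X 2 (\<lambda>p xs. xs ! 0 div Suc (xs ! 1))" unfolding div .
qed

lemma computable_on_div [computable_intros]:
  assumes "computable_on X k f"
  shows "computable_on X k (\<lambda>p xs. f p xs div numeral c)"
  using computable_on_div_Suc[OF assms computable_on_const, of "pred_numeral c"]
  by (simp add: numeral_eq_Suc)

lemma computable_on_mod [computable_intros]:
  assumes "computable_on X k f"
  shows "computable_on X k (\<lambda>p xs. f p xs mod numeral c)"
  unfolding minus_mult_div_eq_mod[symmetric] by (intro computable_intros assms)

lemma computable_on_triangle [computable_intros]:
  assumes "computable_on X k f" shows "computable_on X k (\<lambda>p xs. triangle (f p xs))"
  unfolding triangle_def by (intro computable_intros assms)

lemma computable_on_prod_encode [computable_intros]: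
  assumes "computable_on X k f" "computable_on X k g"
  shows "computable_on X k (\<lambda>p xs. prod_encode (f p xs, g p xs))"
  unfolding prod_encode_def prod.case by (intro computable_intros assms)

lemma triangle_mono: "m \<le> n \<Longrightarrow> triangle m \<le> triangle n"
  unfolding triangle_def by (intro div_le_mono mult_le_mono) auto

text \<open>
  The pairs on the antidiagonal of sum \<open>d\<close> have codes from \<open>triangle d\<close> up to but excluding
  \<open>triangle (Suc d)\<close>. Searching for \<open>d\<close> gives the sum of the components, and the offset from
  \<open>triangle d\<close> is the first one.
\<close>

lemma computable_on_prod_decode:
  assumes "computable_on X k f"
  shows computable_on_fst_prod_decode [computable_intros]: "computable_on X k (\<lambda>p xs. fst (prod_decode (f p xs)))"
    and computable_on_snd_prod_decode [computable_intros]: "computable_on X k (\<lambda>p xs. snd (prod_decode (f p xs)))"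
proof -
  have diag: "(LEAST d. n < triangle (Suc d)) = fst (prod_decode n) + snd (prod_decode n)" for n
  proof -
    obtain a b where ab: "prod_decode n = (a, b)" by fastforce
    then have n: "n = triangle (a + b) + a" using prod_decode_inverse[of n] by (simp add: prod_encode_def)
    have "(LEAST d. n < triangle (Suc d)) = a + b"
    proof (rule Least_equality)
      show "n < triangle (Suc (a + b))" using n by simp
      fix d assume "n < triangle (Suc d)"
      then show "a + b \<le> d"
        using triangle_mono[of "Suc d" "a + b"] n by (intro leI notI) simp
    qed
    then show ?thesis using ab by simp
  qed
  have "\<exists>d. n < triangle (Suc d)" for n
    by (intro exI[of _ n]) simp
  then have "computable_on X 1 (\<lambda>p xs. LEAST d. xs ! 0 < triangle (Suc d))"
    by (intro computable_on_Least computable_intros) auto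
  then have "computable_on X 1 (\<lambda>p xs. fst (prod_decode (xs ! 0)) + snd (prod_decode (xs ! 0)))"
    unfolding diag .
  from computable_on_apply[where F = "\<lambda>p n. fst (prod_decode n) + snd (prod_decode n)", OF this assms]
  have d: "computable_on X k (\<lambda>p xs. fst (prod_decode (f p xs)) + snd (prod_decode (f p xs)))" .
  have fst: "fst (prod_decode n) = n - triangle (fst (prod_decode n) + snd (prod_decode n))" for n
    using prod_decode_inverse[of n]
    by (cases "prod_decode n") (auto simp: prod_encode_def simp del: prod_decode_inverse)
  have "computable_on X k
      (\<lambda>p xs. f p xs - triangle (fst (prod_decode (f p xs)) + snd (prod_decode (f p xs))))"
    by (intro computable_intros d assms)
  then show 1: "computable_on X k (\<lambda>p xs. fst (prod_decode (f p xs)))"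
    unfolding fst[symmetric] .
  have "computable_on X k
      (\<lambda>p xs. fst (prod_decode (f p xs)) + snd (prod_decode (f p xs)) - fst (prod_decode (f p xs)))"
    by (intro computable_intros d 1)
  then show "computable_on X k (\<lambda>p xs. snd (prod_decode (f p xs)))" by simp
qed

section \<open>The unary word of a sequence\<close>

lemma unary_word_blocks:
  fixes w :: baire
  shows "unary_word w ((\<Sum>i<k. Suc (w i)) + w k)"
    and "m < w k \<Longrightarrow> \<not> unary_word w ((\<Sum>i<k. Suc (w i)) + m)"
proof -
  let ?S = "\<Sum>i<k. Suc (w i)"
  have split: "[0..<\<Sum>i<Suc k. Suc (w i)] = [0..<?S] @ [?S..<?S + Suc (w k)]"
    using upt_add_eq_append[of 0 ?S "Suc (w k)"] by (simp del: upt_Suc)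
  have "[0..<Suc k] = [0..<k] @ [k]" by simp
  then have "map (unary_word w) [?S..<?S + Suc (w k)] = replicate (w k) False @ [True]"
    using unary_word_prefix[of w "Suc k"] unary_word_prefix[of w k]
    unfolding split by (simp del: upt_Suc)
  then have nth: "unary_word w (?S + m) = (replicate (w k) False @ [True]) ! m" if "m < Suc (w k)" for m
    using that nth_map[of m "[?S..<?S + Suc (w k)]" "unary_word w"] by (simp del: upt_Suc)
  show "unary_word w (?S + w k)" using nth[of "w k"] by (simp add: nth_append)
  show "\<not> unary_word w (?S + m)" if "m < w k" using nth[of m] that by (simp add: nth_append)
qed

text \<open>
  This is how a sequence is recovered from its word: the number of bits \<open>0\<close> between the start of a
  block and the next bit \<open>1\<close> is the entry coded by the block.
\<close>

lemma unary_word_gap: "(LEAST m. unary_word w ((\<Sum>i<k. Suc (w i)) + m)) = w k"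
  using unary_word_blocks[where w = w and k = k] by (intro Least_equality) (auto simp: not_less[symmetric])

lemma unary_word_unbounded: "\<exists>m. unary_word w (n + m)"
  unfolding unary_word_def by (intro exI[of _ "\<Sum>i\<le>n. w i"] exI[of _ n]) simp

text \<open>
  The block that ends at position \<open>n\<close> has index at most \<open>n\<close>, so the quantifier can be bounded and the
  bits of the word are computable from the sequence.
\<close>

lemma unary_word_bounded: "unary_word w n \<longleftrightarrow> 0 < (\<Sum>k<Suc n. of_bool (n = (\<Sum>i<Suc k. w i) + k) :: nat)"
proof -
  have "unary_word w n \<longleftrightarrow> (\<exists>k<Suc n. n = (\<Sum>i<Suc k. w i) + k)"
    unfolding unary_word_def lessThan_Suc_atMost by (metis le_add2 less_Suc_eq_le)
  also have "\<dots> \<longleftrightarrow> 0 < (\<Sum>k<Suc n. of_bool (n = (\<Sum>i<Suc k. w i) + k) :: nat)"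
    by (auto simp: sum_eq_0_iff zero_less_iff_neq_zero simp del: sum.lessThan_Suc)
  finally show ?thesis .
qed

section \<open>Reading the Cantor word off a Cauchy name\<close>

text \<open>
  The number \<open>2 * cantor_prefix b n\<close> is the integer whose \<open>n\<close> ternary digits are the first \<open>n\<close>
  digits, \<open>0\<close> or \<open>2\<close>, of \<open>\<tau> b\<close>; halving it turns the digits into the bits themselves.
\<close>

definition cantor_prefix :: "cantor \<Rightarrow> nat \<Rightarrow> nat" where
  "cantor_prefix b n = (\<Sum>i<n. of_bool (b i) * 3 ^ (n - Suc i))"

lemma cantor_prefix_0 [simp]: "cantor_prefix b 0 = 0"
  by (simp add: cantor_prefix_def)

lemma cantor_prefix_Suc: "cantor_prefix b (Suc n) = 3 * cantor_prefix b n + of_bool (b n)"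
proof -
  have "(\<Sum>i<n. of_bool (b i) * 3 ^ (Suc n - Suc i)) = (\<Sum>i<n. 3 * (of_bool (b i) * 3 ^ (n - Suc i)) :: nat)"
    by (intro sum.cong refl) (auto simp: Suc_diff_Suc[symmetric] simp flip: power_Suc)
  then show ?thesis by (simp add: cantor_prefix_def sum_distrib_left del: sum_of_bool_mult_eq)
qed

lemma tau_prefix: "3 ^ n * \<tau> b = 2 * real (cantor_prefix b n) + \<tau> (\<lambda>i. b (n + i))"
proof (induction n)
  case (Suc n)
  have "3 ^ Suc n * \<tau> b = 6 * real (cantor_prefix b n) + 3 * \<tau> (\<lambda>i. b (n + i))"
    using Suc.IH by simp
  also have "\<tau> (\<lambda>i. b (n + i)) = 2 / 3 * of_bool (b n) + \<tau> (\<lambda>i. b (Suc n + i)) / 3"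
    using tau_Suc[of "\<lambda>i. b (n + i)"] by simp
  finally show ?case by (simp add: cantor_prefix_Suc)
qed simp

text \<open>
  For the approximation \<open>r = a' / (b + 1)\<close> with error at most \<open>2 ^ -(2 n + 2)\<close>, this is
  \<open>\<lfloor>(2 \<cdot> 3 ^ n \<cdot> r + 1) / 4\<rfloor>\<close> in natural arithmetic. In the integer coding even numbers stand for the
  nonnegative integers; a negative \<open>r\<close> is replaced by \<open>0\<close>, which can only reduce its distance to a
  point of the Cantor set. The approximations are read
  from column \<open>0\<close> of the oracle, which holds the payload evaluation both in table names and in names of
  the transcript of a single payload query.
\<close>

definition prefix_of_name :: "baire \<Rightarrow> nat \<Rightarrow> nat" where
  "prefix_of_name p n = (let (a, b) = prod_decode (p (prod_encode (0, 2 * n + 2)))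
     in (2 * 3 ^ n * (if a mod 2 = 0 then a div 2 else 0) + Suc b) div Suc (4 * b + 3))"

text \<open>
  Scaled by \<open>3 ^ n\<close> the real lies in \<open>[2 M, 2 M + 1]\<close>, where \<open>M\<close> is the wanted prefix, while the intervals
  for different prefixes are at least \<open>1\<close> apart. The scaled error is at most \<open>3 ^ n / 4 ^ (n + 1) \<le> 1/4\<close>, less
  than half of such a gap, so rounding is unambiguous.
\<close>

lemma prefix_of_name_correct:
  assumes "cauchy_name (col_of p 0) (\<tau> c)"
  shows "prefix_of_name p n = cantor_prefix c n"
proof -
  obtain a b where ab: "prod_decode (p (prod_encode (0, 2 * n + 2))) = (a, b)" by fastforce
  define A where "A = (if a mod 2 = 0 then a div 2 else 0 :: nat)"
  have A: "real A = max 0 (real_of_int (int_decode a))"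
    by (auto simp: A_def int_decode_def sum_decode_def even_iff_mod_2_eq_zero)
  have "\<bar>real_of_int (int_decode a) / real (Suc b) - \<tau> c\<bar> \<le> (1/2) ^ (2 * n + 2)"
    using assms ab unfolding cauchy_name_def col_of_def rat_of_code_def
    by (metis (no_types, lifting) case_prod_conv)
  moreover have "real A / real (Suc b) = max 0 (real_of_int (int_decode a) / real (Suc b))"
    unfolding A max_def zero_le_divide_iff by simp
  ultimately have "\<bar>real A / real (Suc b) - \<tau> c\<bar> \<le> (1/2) ^ (2 * n + 2)"
    using tau_bounds(1)[of c] by linarith
  also have "\<dots> = (1/4) ^ n / 4" by (simp add: power_mult power2_eq_square power_one_over[symmetric])
  finally have "3 ^ n * \<bar>real A / real (Suc b) - \<tau> c\<bar> \<le> 3 ^ n * ((1/4) ^ n / 4)"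
    by (intro mult_left_mono) auto
  also have "\<dots> \<le> 1/4"
    using power_mono[of "3::real" 4 n] by (simp add: power_divide field_simps)
  also have "3 ^ n * \<bar>real A / real (Suc b) - \<tau> c\<bar> = \<bar>3 ^ n * real A / real (Suc b) - 3 ^ n * \<tau> c\<bar>"
    by (simp only: times_divide_eq_right[symmetric] right_diff_distrib[symmetric] abs_mult power_abs abs_numeral)
  finally have close: "\<bar>3 ^ n * real A / real (Suc b) - 3 ^ n * \<tau> c\<bar> \<le> 1/4" .
  let ?M = "cantor_prefix c n"
  have "2 * real ?M - 1/4 \<le> 3 ^ n * real A / real (Suc b)"
    "3 ^ n * real A / real (Suc b) \<le> 2 * real ?M + 5/4"
    using close tau_prefix[of n c] tau_bounds[of "\<lambda>i. c (n + i)"] unfolding abs_le_iff by linarith+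
  then have "(2 * real ?M - 1/4) * real (Suc b) \<le> 3 ^ n * real A"
    "3 ^ n * real A \<le> (2 * real ?M + 5/4) * real (Suc b)"
    by (auto simp: pos_le_divide_eq pos_divide_le_eq)
  moreover have "4 * (m * s) \<le> 2 * x + s \<and> 2 * x + s < 4 * (m * s) + 4 * s"
    if "(2 * m - 1/4) * s \<le> x" "x \<le> (2 * m + 5/4) * s" "0 < s" for m s x :: real
    using that by (simp add: algebra_simps)
  ultimately have "4 * (real ?M * real (Suc b)) \<le> 2 * (3 ^ n * real A) + real (Suc b)"
    "2 * (3 ^ n * real A) + real (Suc b) < 4 * (real ?M * real (Suc b)) + 4 * real (Suc b)"
    by (metis of_nat_0_less_iff zero_less_Suc)+
  then have "real (?M * Suc (4 * b + 3)) \<le> real (2 * 3 ^ n * A + Suc b)"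
    "real (2 * 3 ^ n * A + Suc b) < real (Suc ?M * Suc (4 * b + 3))"
    by (auto simp: algebra_simps)
  then have "?M * Suc (4 * b + 3) \<le> 2 * 3 ^ n * A + Suc b"
    "2 * 3 ^ n * A + Suc b < Suc ?M * Suc (4 * b + 3)"
    unfolding of_nat_le_iff of_nat_less_iff .
  then have "(2 * 3 ^ n * A + Suc b) div Suc (4 * b + 3) = ?M"
    by (intro div_nat_eqI) (auto simp: mult.commute)
  then show ?thesis by (simp only: prefix_of_name_def ab A_def Let_def prod.case)
qed

definition bit_of_name :: "baire \<Rightarrow> nat \<Rightarrow> bool" where
  "bit_of_name p n \<longleftrightarrow> prefix_of_name p (Suc n) mod 3 = 1"

lemma bit_of_name_correct:
  assumes "cauchy_name (col_of p 0) (\<tau> b)" shows "bit_of_name p = b"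
  by (rule ext) (simp add: bit_of_name_def prefix_of_name_correct[OF assms] cantor_prefix_Suc
      of_bool_def mod_mult_self4)

definition block_start :: "baire \<Rightarrow> nat \<Rightarrow> nat" where
  "block_start p = rec_nat 0 (\<lambda>_ s. s + Suc (LEAST m. bit_of_name p (s + m)))"

definition word_of_name :: "baire \<Rightarrow> baire" where
  "word_of_name p k = (LEAST m. bit_of_name p (block_start p k + m))"

lemma word_of_name_correct:
  assumes "cauchy_name (col_of p 0) (\<kappa> w)" shows "word_of_name p = w"
proof
  have bit: "bit_of_name p = unary_word w"
    using assms unfolding \<kappa>_def by (rule bit_of_name_correct)
  have "block_start p k = (\<Sum>i<k. Suc (w i))" for k
    by (induction k) (simp_all add: block_start_def bit unary_word_gap)
  then show "word_of_name p k = w k" for k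
    by (simp add: word_of_name_def bit unary_word_gap)
qed

text \<open>
  On these oracles every search for a next bit \<open>1\<close> succeeds, since unary words have infinitely many.
\<close>

definition kappa_names :: "baire set" where
  "kappa_names = {p. \<exists>w. cauchy_name (col_of p 0) (\<kappa> w)}"

lemma computable_prefix_of_name [computable_intros]:
  assumes "computable_on X k f" shows "computable_on X k (\<lambda>p xs. prefix_of_name p (f p xs))"
  unfolding prefix_of_name_def Let_def case_prod_unfold
  by (intro computable_on_div_Suc computable_intros assms)

lemma computable_bit_of_name [computable_intros]:
  assumes "computable_on X k f" shows "computable_on X k (\<lambda>p xs. of_bool (bit_of_name p (f p xs)))"
  unfolding bit_of_name_def by (intro computable_intros assms)

lemma bit_of_name_unbounded:
  assumes "p \<in> kappa_names" shows "\<exists>m. bit_of_name p (n + m)"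
proof -
  obtain w where "cauchy_name (col_of p 0) (\<kappa> w)" using assms unfolding kappa_names_def by blast
  then have "bit_of_name p = unary_word w" unfolding \<kappa>_def by (rule bit_of_name_correct)
  then show ?thesis using unary_word_unbounded by simp
qed

lemma computable_next_bit:
  assumes "computable_on kappa_names k f"
  shows "computable_on kappa_names k (\<lambda>p xs. LEAST m. bit_of_name p (f p xs + m))"
  by (intro computable_on_Least computable_intros computable_on_tl assms bit_of_name_unbounded)

lemma computable_word_of_name [computable_intros]:
  assumes "computable_on kappa_names k f"
  shows "computable_on kappa_names k (\<lambda>p xs. word_of_name p (f p xs))"
  unfolding word_of_name_def block_start_def
  by (intro computable_next_bit computable_on_rec_nat computable_intros computable_on_tl assms)

section \<open>Encoding a reindexed sequence\<close>

text \<open>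
  The partial sum \<open>2 * cantor_prefix b j / 3 ^ j\<close> of \<open>\<tau> b\<close>. The factor \<open>4\<close> arises because the code of a
  nonnegative integer \<open>i\<close> is \<open>2 * i\<close>, and \<open>- 1\<close> because codes store the predecessor of the
  denominator.
\<close>

definition tau_code :: "cantor \<Rightarrow> baire" where
  "tau_code b j = prod_encode (4 * cantor_prefix b j, 3 ^ j - 1)"

text \<open>
  The omitted tail is \<open>3 ^ -j\<close> times a value of \<open>\<tau>\<close>, hence at most \<open>3 ^ -j \<le> 2 ^ -j\<close>.
\<close>

lemma cauchy_name_tau_code: "cauchy_name (tau_code b) (\<tau> b)"
  unfolding cauchy_name_def
proof
  fix j
  have num: "int_decode (4 * n) = 2 * int n" for n
    by (simp add: int_decode_def sum_decode_def)
  have den: "real (Suc (3 ^ j - 1)) = 3 ^ j" by simp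
  have "rat_of_code (tau_code b j) = 2 * real (cantor_prefix b j) / 3 ^ j"
    by (simp add: rat_of_code_def tau_code_def num den del: of_nat_Suc)
  moreover have "\<tau> b = 2 * real (cantor_prefix b j) / 3 ^ j + \<tau> (\<lambda>i. b (j + i)) / 3 ^ j"
    using tau_prefix[of j b] by (simp add: field_simps)
  moreover have "\<tau> (\<lambda>i. b (j + i)) / 3 ^ j \<le> 1 / 2 ^ j" "0 \<le> \<tau> (\<lambda>i. b (j + i)) / 3 ^ j"
    using tau_bounds[of "\<lambda>i. b (j + i)"] power_mono[of 2 "3::real" j]
    by (auto intro!: frac_le)
  ultimately show "\<bar>rat_of_code (tau_code b j) - \<tau> b\<bar> \<le> (1/2) ^ j"
    by (simp add: power_one_over)
qed

text \<open>
  The premise on \<open>w\<close> is closed under substitution, because \<open>w\<close> is used below the bounded sums that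
  search for the end of a block, where the arguments have other arities.
\<close>

lemma computable_tau_code:
  assumes w: "\<And>k f. computable_on X k f \<Longrightarrow> computable_on X k (\<lambda>p xs. w p (f p xs))"
    and f: "computable_on X k f"
  shows "computable_on X k (\<lambda>p xs. tau_code (unary_word (w p)) (f p xs))"
proof (rule computable_on_apply[OF _ f])
  have [computable_intros]: "computable_on X k (\<lambda>p xs. of_bool (unary_word (w p) (f p xs)))"
    if "computable_on X k f" for k f
    unfolding unary_word_bounded
    by (rule computable_on_apply[where F = "\<lambda>p n. of_bool (0 < (\<Sum>k<Suc n. of_bool (n = (\<Sum>i<Suc k. w p i) + k) :: nat))", OF _ that])
      (intro computable_intros w, simp_all)
  show "computable_on X 1 (\<lambda>p xs. tau_code (unary_word (w p)) (xs ! 0))"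
    unfolding tau_code_def cantor_prefix_def by (intro computable_intros) simp_all
qed

definition reindexed_name :: "(nat \<Rightarrow> nat) \<Rightarrow> baire \<Rightarrow> baire" where
  "reindexed_name f p = tau_code (unary_word (word_of_name p \<circ> f))"

lemma cauchy_name_reindexed:
  assumes "cauchy_name (col_of p 0) (\<kappa> w)"
  shows "cauchy_name (reindexed_name f p) (\<kappa> (w \<circ> f))"
  unfolding reindexed_name_def word_of_name_correct[OF assms] \<kappa>_def by (rule cauchy_name_tau_code)

lemma computable_reindexed_name:
  assumes "\<And>k g. computable_on kappa_names k g \<Longrightarrow> computable_on kappa_names k (\<lambda>p xs. f (g p xs))"
    and "computable_on kappa_names k g"
  shows "computable_on kappa_names k (\<lambda>p xs. reindexed_name f p (g p xs))"
  unfolding reindexed_name_def using assms by (intro computable_tau_code) (auto intro!: computable_intros)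

section \<open>Computable transports by reindexing\<close>

lemma shifted_problem_simps [simp]:
  "instances (shifted_problem W A) = W \<times> UNIV"
  "outputs (shifted_problem W A) = {0..1}"
  "out_name (shifted_problem W A) = cauchy_name"
  "evaluation (shifted_problem W A) = payload_eval"
  "solutions (shifted_problem W A) (w, b) = (\<lambda>x. shift b + ell * x) ` A w"
  by (simp_all add: shifted_problem_def)

text \<open>
  Reindexing the payload by a computable \<open>f\<close> is a computable transport as soon as it shrinks the solution
  sets. Each evaluation of the target needs one query with the same index: bit evaluations agree, and
  the payload evaluation is obtained by decoding, reindexing and re-encoding.
\<close>

lemma shifted_problem_reindex:
  assumes f: "\<And>X k g. computable_on X k g \<Longrightarrow> computable_on X k (\<lambda>p xs. f (g p xs))"
    and W: "\<And>w. w \<in> W \<Longrightarrow> w \<circ> f \<in> W'"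
    and A: "\<And>w. w \<in> W \<Longrightarrow> A' (w \<circ> f) \<noteq> {} \<and> A' (w \<circ> f) \<subseteq> A w"
  shows "shifted_problem W A \<le>TTE_fq shifted_problem W' A'"
proof -
  let ?S = "shifted_problem W A" and ?P = "shifted_problem W' A'"
  define E :: "baire \<times> cantor \<Rightarrow> baire \<times> cantor" where "E = (\<lambda>(w, b). (w \<circ> f, b))"
  have eval_0: "payload_eval 0 (E x) = \<kappa> (fst x \<circ> f)" and eval_Suc: "payload_eval (Suc n) (E x) = payload_eval (Suc n) x"
    for n x by (simp_all add: E_def payload_eval_def case_prod_unfold)
  define F where "F = reindexed_name f"
  have F: "computable_on kappa_names k (\<lambda>p xs. F p (g p xs))" if "computable_on kappa_names k g" for k g
    unfolding F_def using f that by (rule computable_reindexed_name)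
  note F_name = cauchy_name_reindexed[where f = f, folded F_def]
  obtain r0 where r0: "\<And>p. p \<in> kappa_names \<Longrightarrow> computes r0 p (F p)"
  proof -
    have "computable_on kappa_names 1 (\<lambda>p xs. F p (xs ! 0))" by (intro F computable_intros) simp
    then obtain r where "\<And>p xs. p \<in> kappa_names \<Longrightarrow> length xs = 1 \<Longrightarrow> run r p xs = Some (F p (xs ! 0))"
      unfolding computable_on_def by blast
    then show thesis by (intro that[of r]) (simp add: computes_def)
  qed
  obtain r1 where r1: "\<And>p. computes r1 p (col_of p 0)"
  proof -
    have "computable_on UNIV 1 (\<lambda>p xs. p (prod_encode (0, xs ! 0)))" by (intro computable_intros) simp
    then obtain r where "\<And>p xs. length xs = 1 \<Longrightarrow> run r p xs = Some (p (prod_encode (0, xs ! 0)))"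
      unfolding computable_on_def by blast
    then show thesis by (intro that[of r]) (simp add: computes_def col_of_def)
  qed
  have queries: "effective_queries ?S ?P E"
    unfolding effective_queries_def
  proof (intro exI conjI allI)
    let ?g = "\<lambda>e. prod_encode (list_encode [e], if e = 0 then code r0 else code r1)"
    have "computable_on UNIV 1 (\<lambda>p xs. ?g (xs ! 0))"
      unfolding list_encode.simps by (intro computable_intros) simp_all
    then show "computable_nat ?g"
      unfolding computable_on_def computable_nat_def by (metis UNIV_I length_Cons list.size(3) nth_Cons_0 One_nat_def)
    fix e :: nat
    \<comment> \<open>the inverse of \<open>\<kappa>\<close> is meaningful only on its range, so the reconstruction is partial\<close>
    define \<theta> where "\<theta> = (\<lambda>xs. if e = 0
      then if \<exists>w. xs = [\<kappa> w] then Some (\<kappa> (inv \<kappa> (hd xs) \<circ> f)) else None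
      else if length xs = 1 then Some (hd xs) else None)"
    show "?g e = prod_encode (list_encode [e], code (if e = 0 then r0 else r1))" by simp
    show "dom \<theta> \<subseteq> {xs. length xs = length [e]}"
      by (auto simp: \<theta>_def dom_def split: if_splits)
    show "transcript ?S [e] ` instances ?S \<subseteq> dom \<theta>"
      by (auto simp: \<theta>_def transcript_def payload_eval_def)
    show "realizes (if e = 0 then r0 else r1) tuple_name cauchy_name (dom \<theta>) (the \<circ> \<theta>)"
    proof (cases "e = 0")
      case True
      show ?thesis unfolding realizes_def
      proof (intro ballI allI impI)
        fix xs p assume "xs \<in> dom \<theta>" and p: "tuple_name p xs"
        then obtain w where xs: "xs = [\<kappa> w]" using True by (auto simp: \<theta>_def split: if_splits)
        then have name: "cauchy_name (col_of p 0) (\<kappa> w)" using p by (simp add: tuple_name_def)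
        have "(the \<circ> \<theta>) xs = \<kappa> (w \<circ> f)" using True inj_kappa by (auto simp: \<theta>_def xs)
        then show "\<exists>q. computes (if e = 0 then r0 else r1) p q \<and> cauchy_name q ((the \<circ> \<theta>) xs)"
          using True r0[of p] F_name[OF name] name unfolding kappa_names_def by auto
      qed
    next
      case False
      then show ?thesis
        by (auto simp: realizes_def \<theta>_def tuple_name_def length_Suc_conv split: if_splits) (use r1 in blast)
    qed
    show "\<forall>x\<in>instances ?S. \<theta> (transcript ?S [e] x) = Some (evaluation ?P e (E x))"
      by (cases e) (auto simp: \<theta>_def transcript_def eval_0 eval_Suc,
          auto simp: payload_eval_def inj_kappa dest!: injD[OF inj_kappa])
  qed
  have raw: "raw_fq_transport ?S ?P E id"
    unfolding raw_fq_transport_def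
  proof (intro conjI)
    show "E \<in> instances ?S \<rightarrow> instances ?P" using W by (auto simp: E_def)
    show "\<forall>x\<in>instances ?S. id ` solutions ?P (E x) \<noteq> {} \<and> id ` solutions ?P (E x) \<subseteq> solutions ?S x"
      using A by (auto simp: E_def)
    show "\<forall>e. \<exists>is \<theta>. \<forall>x\<in>instances ?S. evaluation ?P e (E x) = \<theta> (transcript ?S is x)"
      using queries unfolding effective_queries_def by (metis option.sel)
  qed auto
  obtain rE where rE: "realizes rE (table_name ?S) (table_name ?P) (instances ?S) E"
  proof -
    let ?out = "\<lambda>p n. if fst (prod_decode n) = 0 then F p (snd (prod_decode n)) else p n"
    have "computable_on kappa_names 1 (\<lambda>p xs. ?out p (xs ! 0))" by (intro F computable_intros) simp_all
    then obtain r where r: "\<And>p xs. p \<in> kappa_names \<Longrightarrow> length xs = 1 \<Longrightarrow> run r p xs = Some (?out p (xs ! 0))"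
      unfolding computable_on_def by blast
    show thesis
    proof (rule that, unfold realizes_def, intro ballI allI impI)
      fix x p assume p: "table_name ?S p x"
      then have name: "cauchy_name (col_of p 0) (\<kappa> (fst x))"
        unfolding table_name_def by (auto simp: payload_eval_def dest: spec[of _ 0])
      then have "p \<in> kappa_names" unfolding kappa_names_def by blast
      then have "computes r p (?out p)" using r[of p] by (simp add: computes_def)
      moreover have "cauchy_name (col_of (?out p) e) (payload_eval e (E x))" for e
      proof (cases e)
        case 0
        then show ?thesis using F_name[OF name] by (simp add: col_of_def eval_0)
      next
        case (Suc n)
        then have "col_of (?out p) e = col_of p e" by (simp add: col_of_def)
        then show ?thesis using p unfolding table_name_def Suc eval_Suc by simp
      qed
      ultimately show "\<exists>q. computes r p q \<and> table_name ?P q (E x)"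
        unfolding table_name_def by auto
    qed
  qed
  have "realizes Query cauchy_name cauchy_name {0..1} (id :: real \<Rightarrow> real)"
    by (auto simp: realizes_def computes_def)
  with raw rE queries show ?thesis unfolding TTE_fq_le_def by auto
qed

lemma P_A_TTE_le_P_B: "P_A \<le>TTE_fq P_B"
  unfolding P_A_def P_B_def
proof (rule shifted_problem_reindex[where f = "\<lambda>n. 2 * n"])
  fix w assume "w \<in> DH_A"
  then obtain u v where w: "w = pair u v" "u \<in> D_H" unfolding DH_A_def by blast
  have half: "w \<circ> (\<lambda>n. 2 * n) = u" by (simp add: w pair_def fun_eq_iff)
  show "w \<circ> (\<lambda>n. 2 * n) \<in> DH_B" unfolding half DH_B_def by (rule w)
  show "zeros (h_B (w \<circ> (\<lambda>n. 2 * n))) \<noteq> {} \<and> zeros (h_B (w \<circ> (\<lambda>n. 2 * n))) \<subseteq> zeros (h_A w)"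
    unfolding half using zeros_nonempty[OF rep_H_in[OF w(2)]] by (simp add: h_A_def h_B_def w)
qed (intro computable_intros)

definition constant_columns :: "baire \<Rightarrow> baire" where
  "constant_columns u = u \<circ> (\<lambda>n. snd (prod_decode n))"

lemma limB_constant_columns [simp]:
  "constant_columns u \<in> limB_dom" "limB (constant_columns u) = u"
  by (auto simp: constant_columns_def limB_dom_def intro!: limB_eqI)

lemma P_B_TTE_le_P_C: "P_B \<le>TTE_fq P_C"
  unfolding P_B_def P_C_def
proof (rule shifted_problem_reindex[where f = "\<lambda>n. snd (prod_decode n)"], fold constant_columns_def)
  fix w assume "w \<in> DH_B"
  then have w: "w \<in> D_H" by (simp add: DH_B_def)
  then show "constant_columns w \<in> DH_C" by (simp add: DH_C_def)
  show "zeros (h_C (constant_columns w)) \<noteq> {} \<and> zeros (h_C (constant_columns w)) \<subseteq> zeros (h_B w)"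
    using zeros_nonempty[OF rep_H_in[OF w]] by (simp add: h_B_def h_C_def)
qed (intro computable_intros)

section \<open>Raw transports through singleton solution sets\<close>

definition attains_all_singletons :: "baire set \<Rightarrow> (baire \<Rightarrow> real set) \<Rightarrow> bool" where
  "attains_all_singletons W A \<longleftrightarrow> (\<forall>w\<in>W. A w \<noteq> {} \<and> A w \<subseteq> {1/3..2/3}) \<and> (\<forall>z\<in>{1/3..2/3}. \<exists>w\<in>W. A w = {z})"

text \<open>
  Pick a point of each solution set and move to an instance with exactly this solution. The payload
  evaluation is injective, so its value at the new payload is a function of its value at the old one,
  which makes a single query suffice.
\<close>

lemma raw_fq_le_if_attains_all_singletons:
  assumes "attains_all_singletons W A" "attains_all_singletons W' A'"
  shows "shifted_problem W A \<le>raw_fq shifted_problem W' A'"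
proof -
  have "\<forall>w\<in>W. \<exists>w'. w' \<in> W' \<and> A' w' \<noteq> {} \<and> A' w' \<subseteq> A w"
  proof
    fix w assume "w \<in> W"
    then obtain z where z: "z \<in> A w" "z \<in> {1/3..2/3}"
      using assms(1) unfolding attains_all_singletons_def by blast
    then obtain w' where "w' \<in> W'" "A' w' = {z}"
      using assms(2) unfolding attains_all_singletons_def by blast
    then show "\<exists>w'. w' \<in> W' \<and> A' w' \<noteq> {} \<and> A' w' \<subseteq> A w"
      using z(1) by (intro exI[of _ w']) simp
  qed
  from bchoice[OF this] obtain g where
    g: "\<And>w. w \<in> W \<Longrightarrow> g w \<in> W' \<and> A' (g w) \<noteq> {} \<and> A' (g w) \<subseteq> A w" by blast
  have "raw_fq_transport (shifted_problem W A) (shifted_problem W' A') (\<lambda>(w, b). (g w, b)) id"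
    unfolding raw_fq_transport_def
  proof (intro conjI allI)
    fix e
    show "\<exists>is \<theta>. \<forall>x\<in>instances (shifted_problem W A).
        evaluation (shifted_problem W' A') e (case x of (w, b) \<Rightarrow> (g w, b)) =
        \<theta> (transcript (shifted_problem W A) is x)"
      by (rule exI[of _ "[e]"], rule exI[of _ "\<lambda>xs. if e = 0 then \<kappa> (g (inv \<kappa> (hd xs))) else hd xs"])
        (auto simp: transcript_def payload_eval_def inj_kappa split: nat.split)
  qed (use g in auto)
  then show ?thesis unfolding raw_fq_le_def by blast
qed

section \<open>Every singleton is attained\<close>

lemma rat_of_code_surj_Rats:
  assumes "x \<in> \<rat>" shows "\<exists>c. rat_of_code c = x"
proof -
  obtain a b where ab: "x = real_of_int a / real_of_int b" "b > 0"
    using assms by (metis Rats_cases')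
  then have "real (Suc (nat b - 1)) = real_of_int b" by simp
  then have "rat_of_code (prod_encode (int_encode a, nat b - 1)) = x"
    using ab by (simp add: rat_of_code_def del: of_nat_Suc)
  then show ?thesis ..
qed

lemma rat_of_code_in_Rats: "rat_of_code c \<in> \<rat>"
  by (simp add: rat_of_code_def case_prod_unfold)

lemma cauchy_name_exists: "\<exists>v. cauchy_name v x"
proof -
  have "\<exists>c. \<bar>rat_of_code c - x\<bar> \<le> (1/2) ^ j" for j
  proof -
    obtain r where "r \<in> \<rat>" "x < r" "r < x + (1/2) ^ j"
      using Rats_dense_in_real[of x "x + (1/2) ^ j"] by auto
    then show ?thesis using rat_of_code_surj_Rats[of r] by (metis abs_of_pos diff_gt_0_iff_gt
          less_eq_real_def diff_less_eq add.commute)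
  qed
  then show ?thesis unfolding cauchy_name_def by metis
qed

definition line_vanishing_at :: "real \<Rightarrow> real \<Rightarrow> real" where
  "line_vanishing_at z = restrict (\<lambda>x. x - z) {0..1}"

lemma zeros_line_vanishing_at: "z \<in> {1/3..2/3} \<Longrightarrow> zeros (line_vanishing_at z) = {z}"
  by (auto simp: zeros_def line_vanishing_at_def)

lemma line_vanishing_at_in_HH:
  assumes "z \<in> {1/3..2/3}" shows "line_vanishing_at z \<in> HH"
proof -
  have "continuous_on {0..1} (line_vanishing_at z)"
    by (rule continuous_on_eq[of _ "\<lambda>x. x - z"]) (auto simp: line_vanishing_at_def intro!: continuous_intros)
  moreover have "line_vanishing_at z 0 < 0" "0 < line_vanishing_at z 1"
    using assms by (auto simp: line_vanishing_at_def)
  ultimately show ?thesis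
    using assms zeros_line_vanishing_at[OF assms] by (simp add: HH_def C01_def) (simp add: line_vanishing_at_def)
qed

lemma C_name_line_vanishing_at: "\<exists>u. C_name u (line_vanishing_at z)"
proof -
  have "\<exists>c. valid_vertices (vertices_of_code c) \<and>
      (\<forall>x\<in>{0..1}. \<bar>polygon (vertices_of_code c) x - line_vanishing_at z x\<bar> \<le> (1/2) ^ n)" for n
  proof -
    obtain v where "cauchy_name v (- z)" using cauchy_name_exists by blast
    then have v: "\<bar>rat_of_code (v n) + z\<bar> \<le> (1/2) ^ n" by (auto simp: cauchy_name_def dest: spec[of _ n])
    obtain c0 c1 d where c: "rat_of_code c0 = 0" "rat_of_code c1 = 1" "rat_of_code d = rat_of_code (v n) + 1"
      using rat_of_code_surj_Rats Rats_0 Rats_1 Rats_add rat_of_code_in_Rats by metis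
    \<comment> \<open>approximate by the line of slope one through \<open>(0, r)\<close>, with \<open>r\<close> rational and close to \<open>- z\<close>\<close>
    let ?c = "list_encode [prod_encode (c0, v n), prod_encode (c1, d)]"
    have vs: "vertices_of_code ?c = [(0, rat_of_code (v n)), (1, rat_of_code (v n) + 1)]"
      by (simp add: vertices_of_code_def c del: list_encode.simps)
    show ?thesis
    proof (intro exI conjI ballI)
      show "valid_vertices (vertices_of_code ?c)" unfolding vs by (simp add: valid_vertices_def)
      fix x :: real assume "x \<in> {0..1}"
      then show "\<bar>polygon (vertices_of_code ?c) x - line_vanishing_at z x\<bar> \<le> (1/2) ^ n"
        unfolding vs using v by (simp add: line_vanishing_at_def add.commute)
    qed
  qed
  then show ?thesis unfolding C_name_def by metis
qed

text \<open>
  The name runs through all rational intervals and replaces those that contain \<open>z\<close> by padding.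
\<close>

lemma neg_name_singleton: "\<exists>q. neg_name q {z}"
proof
  define pad where "pad = prod_encode (0, 0)"
  have pad: "interval_of_code pad = {}" by (simp add: pad_def interval_of_code_def)
  define q where "q n = (if z \<in> interval_of_code n then pad else n)" for n
  have "\<exists>n. x \<in> interval_of_code (q n)" if x: "x \<in> {0..1}" "x \<noteq> z" for x
  proof -
    let ?d = "\<bar>x - z\<bar>"
    \<comment> \<open>rational endpoints so close to \<open>x\<close> that the interval cannot reach \<open>z\<close>\<close>
    obtain a where a: "a \<in> \<rat>" "x - ?d < a" "a < x" using Rats_dense_in_real[of "x - ?d" x] x by auto
    obtain b where b: "b \<in> \<rat>" "x < b" "b < x + ?d" using Rats_dense_in_real[of x "x + ?d"] x by auto
    obtain ca cb where "rat_of_code ca = a" "rat_of_code cb = b" using rat_of_code_surj_Rats a b by metis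
    then have I: "interval_of_code (prod_encode (ca, cb)) = {a<..<b} \<inter> {0..1}"
      by (simp add: interval_of_code_def)
    have "z \<notin> {a<..<b}" using a b by (auto simp: abs_if split: if_splits)
    then have "z \<notin> interval_of_code (prod_encode (ca, cb))" unfolding I by blast
    then have "q (prod_encode (ca, cb)) = prod_encode (ca, cb)" unfolding q_def by (rule if_not_P)
    then have "x \<in> interval_of_code (q (prod_encode (ca, cb)))" using a b x by (simp add: I)
    then show ?thesis ..
  qed
  then have "{0..1} - {z} \<subseteq> (\<Union>n. interval_of_code (q n))" by blast
  moreover have "interval_of_code (q n) \<subseteq> {0..1} - {z}" for n
  proof -
    have "z \<notin> interval_of_code (q n)" by (simp add: q_def pad)
    then show ?thesis by (auto simp: interval_of_code_def split: prod.splits)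
  qed
  then have "(\<Union>n. interval_of_code (q n)) \<subseteq> {0..1} - {z}" by (rule UN_least)
  ultimately show "neg_name q {z}" unfolding neg_name_def by (rule antisym[rotated])
qed

lemma exists_H_name_vanishing_at:
  assumes "z \<in> {1/3..2/3}" shows "\<exists>u\<in>D_H. zeros (\<delta>_H u) = {z}"
proof -
  obtain u where u: "C_name u (line_vanishing_at z)" using C_name_line_vanishing_at by blast
  note h = line_vanishing_at_in_HH[OF assms]
  have "u \<in> D_H" unfolding rep_dom_def using h u by blast
  then show ?thesis using rep_H[OF h u] zeros_line_vanishing_at[OF assms] by (intro bexI[of _ u]) simp_all
qed

lemma exists_J_name_of_singleton:
  assumes "z \<in> {1/3..2/3}" shows "\<exists>q\<in>D_J. \<delta>_J q = {z}"
proof -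
  obtain q where q: "neg_name q {z}" using neg_name_singleton by blast
  have J: "{z} \<in> JJ" unfolding JJ_def using assms by (intro CollectI exI[of _ z]) simp
  then have "q \<in> D_J" unfolding rep_dom_def using q by blast
  then show ?thesis using rep_J[OF J q] by (intro bexI[of _ q])
qed

lemma zeros_rep_H:
  assumes "u \<in> D_H" shows "zeros (\<delta>_H u) \<noteq> {} \<and> zeros (\<delta>_H u) \<subseteq> {1/3..2/3}"
  using rep_H_in[OF assms] zeros_nonempty[OF rep_H_in[OF assms]] by (simp add: HH_def)

lemma rep_J_bounds:
  assumes "q \<in> D_J" shows "\<delta>_J q \<noteq> {} \<and> \<delta>_J q \<subseteq> {1/3..2/3}"
proof -
  obtain a b where "\<delta>_J q = {a..b}" "1/3 \<le> a" "a \<le> b" "b \<le> 2/3"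
    using rep_J_in[OF assms] unfolding JJ_def by blast
  then show ?thesis by auto
qed

text \<open>
  The variants with a named solution and with limit names only add or blur information about a
  payload: forgetting it by \<open>e\<close> leaves the solution set as it was, and every payload arises this way.
\<close>

lemma attains_all_singletons_pullback:
  assumes "attains_all_singletons W A" "e ` W' = W"
  shows "attains_all_singletons W' (\<lambda>w. A (e w))"
  using assms unfolding attains_all_singletons_def by blast

lemma attains_all_singletons_with_solution:
  assumes "attains_all_singletons W A"
  shows "attains_all_singletons {pair w v | w v. w \<in> W \<and> (\<exists>x\<in>A w. cauchy_name v x)} (\<lambda>p. A (pair_fst p))"
proof (rule attains_all_singletons_pullback[OF assms], intro equalityI subsetI)
  fix w assume w: "w \<in> W"
  then obtain x where x: "x \<in> A w" using assms unfolding attains_all_singletons_def by blast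
  obtain v where "cauchy_name v x" using cauchy_name_exists by blast
  then show "w \<in> pair_fst ` {pair w v | w v. w \<in> W \<and> (\<exists>x\<in>A w. cauchy_name v x)}"
    using w x by (intro image_eqI[of _ _ "pair w v"]) auto
qed auto

lemma attains_all_singletons_limit:
  assumes "attains_all_singletons W A"
  shows "attains_all_singletons {p \<in> limB_dom. limB p \<in> W} (\<lambda>p. A (limB p))"
proof (rule attains_all_singletons_pullback[OF assms], intro equalityI subsetI)
  fix w assume "w \<in> W"
  then show "w \<in> limB ` {p \<in> limB_dom. limB p \<in> W}"
    by (intro image_eqI[of _ _ "constant_columns w"]) auto
qed auto

lemma six_problems_attain_all_singletons:
  assumes "S \<in> {P_A, Q_A, P_B, Q_B, P_C, Q_C}"
  shows "\<exists>W A. S = shifted_problem W A \<and> attains_all_singletons W A"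
proof -
  have H: "attains_all_singletons D_H (\<lambda>u. zeros (\<delta>_H u))"
    unfolding attains_all_singletons_def using zeros_rep_H exists_H_name_vanishing_at by blast
  have J: "attains_all_singletons D_J \<delta>_J"
    unfolding attains_all_singletons_def using rep_J_bounds exists_J_name_of_singleton by blast
  note defs = DH_A_def DH_B_def DH_C_def DJ_A_def DJ_B_def DJ_C_def
    h_A_def h_B_def h_C_def J_A_def[abs_def] J_B_def[abs_def] J_C_def[abs_def]
  have "attains_all_singletons DH_A (\<lambda>w. zeros (h_A w))" "attains_all_singletons DJ_A J_A"
    unfolding defs by (rule attains_all_singletons_with_solution[OF H] attains_all_singletons_with_solution[OF J])+
  moreover have "attains_all_singletons DH_B (\<lambda>w. zeros (h_B w))" "attains_all_singletons DJ_B J_B"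
    unfolding defs using H J by simp_all
  moreover have "attains_all_singletons DH_C (\<lambda>w. zeros (h_C w))" "attains_all_singletons DJ_C J_C"
    unfolding defs by (rule attains_all_singletons_limit[OF H] attains_all_singletons_limit[OF J])+
  ultimately show ?thesis
    using assms unfolding P_A_def P_B_def P_C_def Q_A_def Q_B_def Q_C_def by blast
qed

theorem proposition7p4:
  shows "P_A \<le>TTE_fq P_B \<and> P_B \<le>TTE_fq P_C \<and>
    (\<forall>S\<in>{P_A, Q_A, P_B, Q_B, P_C, Q_C}. \<forall>P\<in>{P_A, Q_A, P_B, Q_B, P_C, Q_C}. S \<le>raw_fq P)"
proof (intro conjI ballI)
  fix S P assume S: "S \<in> {P_A, Q_A, P_B, Q_B, P_C, Q_C}" and P: "P \<in> {P_A, Q_A, P_B, Q_B, P_C, Q_C}"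
  obtain W A where W: "S = shifted_problem W A" "attains_all_singletons W A"
    using six_problems_attain_all_singletons[OF S] by (elim exE conjE)
  obtain W' A' where W': "P = shifted_problem W' A'" "attains_all_singletons W' A'"
    using six_problems_attain_all_singletons[OF P] by (elim exE conjE)
  show "S \<le>raw_fq P" unfolding W(1) W'(1) by (rule raw_fq_le_if_attains_all_singletons[OF W(2) W'(2)])
qed (rule P_A_TTE_le_P_B P_B_TTE_le_P_C)+

end
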